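(* Let $d\ge 3$. Assume that $F\colon[0,\infty)\to\mathbb R$ fulfills $\mathcal R_dF=\mathcal F_d[\mathcal R_d\rho]$ for some function $\rho\colon[0,\infty)\to\mathbb R$ with $\mathcal R_d\rho\in L^1(\mathbb R^d)$. Then the function $f\colon[0,\infty)\to\mathbb R$ given by (the restriction to $[0,\infty)$ of) the even function $$f=\tfrac{\omega_{d-1}}{2}\,(\mathcal F_1\circ\mathcal M_d)[\rho]\in\mathcal C_0(\mathbb R),$$ where $\rho$ is also considered evenly extended to $\mathbb R$, fulfills $$F(\|x\|)=\mathbb E_{\xi\sim\mathcal U_{\mathbb S^{d-1}}}\big[f(|\langle x,\xi\rangle|)\big]\qquad\text{for all }x\in\mathbb R^d.$$ If in addition $\mathcal R_dF\in L^1(\mathbb R^d)$, then $$f=\tfrac{\omega_{d-1}}{2}\,(\mathcal F_1\circ\mathcal M_d\circ\mathcal A_d\circ\mathcal F_d^{-1}\circ\mathcal R_d)[F].$$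
   Context: $\|\cdot\|$ is the Euclidean norm and $\langle\cdot,\cdot\rangle$ the Euclidean inner product on $\mathbb R^d$; $\mathcal U_{\mathbb S^{d-1}}$ is the uniform distribution on the unit sphere $\mathbb S^{d-1}\subset\mathbb R^d$; $\omega_{d-1}=\frac{2\pi^{d/2}}{\Gamma(d/2)}$ is its surface measure. $\mathcal C_0(\mathbb R)$ is the space of continuous functions on $\mathbb R$ vanishing at infinity. Fourier transform: for $\Phi\in L^1(\mathbb R^d)$, $\mathcal F_d[\Phi](v)=\int_{\mathbb R^d}e^{-2\pi i\langle x,v\rangle}\Phi(x)\,\mathrm dx$ and $\mathcal F_d^{-1}[\Phi](x)=\int_{\mathbb R^d}e^{2\pi i\langle x,v\rangle}\Phi(v)\,\mathrm dv$. Rotation operator: for $F\colon[0,\infty)\to\mathbb R$ (identified with its even extension to $\mathbb R$), $\mathcal R_dF(x):=F(\|x\|)$ for $x\in\mathbb R^d$. Averaging operator: for $\Phi\colon\mathbb R^d\to\mathbb R$ integrable on spheres, $\mathcal A_d\Phi(r):=\frac1{\omega_{d-1}}\int_{\mathbb S^{d-1}}\Phi(r\xi)\,\mathrm d\xi$, $r\in\mathbb R$. Multiplication operator: $\mathcal M_d\rho(r):=\rho(|r|)\,|r|^{d-1}$, $r\in\mathbb R$. *)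

theory Defs
  imports "HOL-Analysis.Analysis"
begin

text \<open>
  \<open>\<real>\<^sup>d\<close> is rendered by a type \<open>'a :: euclidean_space\<close> with \<open>d = DIM('a)\<close>; the dimension one
  case is the type \<^typ>\<open>real\<close>, whose inner product is multiplication. A function on
  \<open>[0,\<infinity>)\<close> is rendered by a function on \<^typ>\<open>real\<close> whose values at negative arguments are
  never used.
\<close>

text \<open>\<open>sphere_area d\<close> is \<open>\<omega>\<^bsub>d-1\<^esub>\<close>, the area of the unit sphere of \<open>\<real>\<^sup>d\<close>.\<close>

definition sphere_area :: "nat \<Rightarrow> real" where
  "sphere_area d = 2 * pi powr (real d / 2) / Gamma (real d / 2)"

text \<open>
  The surface measure of the unit sphere is defined through polar coordinates, as
  \<open>\<sigma>(A) = d \<sqdot> \<lambda> {x. 0 < \<parallel>x\<parallel> < 1 \<and> x / \<parallel>x\<parallel> \<in> A}\<close>; see \<open>emeasure_sphere_measure\<close>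
  for this formula and \<open>emeasure_sphere_measure_sphere\<close> for the total mass.
  Here \<open>sgn x = x /\<^sub>R norm x\<close>.
\<close>

definition sphere_measure :: "'a::euclidean_space measure" where
  "sphere_measure = scale_measure (of_nat DIM('a))
     (distr (restrict_space lborel (ball 0 1 - {0})) (restrict_space borel (sphere 0 1)) sgn)"

definition uniform_sphere :: "'a::euclidean_space measure" where
  "uniform_sphere = uniform_measure sphere_measure (sphere 0 1)"

definition fourier :: "('a::euclidean_space \<Rightarrow> complex) \<Rightarrow> 'a \<Rightarrow> complex" where
  "fourier \<Phi> v = (LINT x|lebesgue. exp (- 2 * pi * \<i> * complex_of_real (x \<bullet> v)) * \<Phi> x)"

definition inv_fourier :: "('a::euclidean_space \<Rightarrow> complex) \<Rightarrow> 'a \<Rightarrow> complex" where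
  "inv_fourier \<Phi> x = (LINT v|lebesgue. exp (2 * pi * \<i> * complex_of_real (x \<bullet> v)) * \<Phi> v)"

definition rot_op :: "(real \<Rightarrow> 'b) \<Rightarrow> 'a::euclidean_space \<Rightarrow> 'b" where
  "rot_op F x = F (norm x)"

definition avg_op ::
  "('a::euclidean_space \<Rightarrow> 'b) \<Rightarrow> real \<Rightarrow> 'b::{banach, second_countable_topology}" where
  "avg_op \<Phi> r = (1 / sphere_area DIM('a)) *\<^sub>R (LINT \<xi>|sphere_measure. \<Phi> (r *\<^sub>R \<xi>))"

definition mult_op :: "nat \<Rightarrow> (real \<Rightarrow> 'b) \<Rightarrow> real \<Rightarrow> 'b::real_vector" where
  "mult_op d \<rho> r = \<bar>r\<bar> ^ (d - 1) *\<^sub>R \<rho> \<bar>r\<bar>"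

definition C0 :: "(real \<Rightarrow> real) set" where
  "C0 = {f. continuous_on UNIV f \<and> (f \<longlongrightarrow> 0) at_infinity}"

lemma space_sphere_measure [simp]: "space sphere_measure = sphere 0 1"
  by (simp add: sphere_measure_def space_scale_measure space_restrict_space)

lemma sets_sphere_measure [measurable_cong]:
  "sets sphere_measure = sets (restrict_space borel (sphere 0 1))"
  by (simp add: sphere_measure_def)

lemma measurable_sgn_sphere:
  "sgn \<in> restrict_space lborel (ball 0 1 - {0 :: 'a::euclidean_space})
           \<rightarrow>\<^sub>M restrict_space borel (sphere 0 1)"
proof (rule measurable_restrict_space2)
  show "sgn \<in> space (restrict_space lborel (ball 0 1 - {0 :: 'a})) \<rightarrow> sphere 0 1"
    by (auto simp: space_restrict_space norm_sgn)
  have "(sgn :: 'a \<Rightarrow> 'a) \<in> borel_measurable borel"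
    unfolding sgn_div_norm[abs_def] by measurable
  then show "(sgn :: 'a \<Rightarrow> 'a) \<in> borel_measurable (restrict_space lborel (ball 0 1 - {0}))"
    by (intro measurable_restrict_space1) simp
qed

lemma emeasure_sphere_measure:
  assumes "A \<in> sets (sphere_measure :: 'a::euclidean_space measure)"
  shows "emeasure (sphere_measure :: 'a measure) A =
    of_nat DIM('a) * emeasure lborel {x \<in> ball 0 1 - {0}. sgn x \<in> A}"
proof -
  have "emeasure (distr (restrict_space lborel (ball 0 1 - {0 :: 'a}))
           (restrict_space borel (sphere 0 1)) sgn) A
      = emeasure (restrict_space lborel (ball 0 1 - {0}))
          (sgn -` A \<inter> space (restrict_space lborel (ball 0 1 - {0})))"
    using assms by (intro emeasure_distr measurable_sgn_sphere) (simp add: sets_sphere_measure)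
  also have "\<dots> = emeasure lborel (sgn -` A \<inter> space (restrict_space lborel (ball 0 1 - {0})))"
    by (rule emeasure_restrict_space) (auto simp: space_restrict_space)
  also have "sgn -` A \<inter> space (restrict_space lborel (ball 0 1 - {0})) =
      {x \<in> ball 0 1 - {0}. sgn x \<in> A}"
    by (auto simp: space_restrict_space)
  finally show ?thesis by (simp add: sphere_measure_def)
qed

lemma emeasure_sphere_measure_sphere:
  "emeasure (sphere_measure :: 'a::euclidean_space measure) (sphere 0 1) =
     ennreal (sphere_area DIM('a))"
proof -
  let ?B = "ball 0 1 :: 'a set"
  have "emeasure (sphere_measure :: 'a measure) (sphere 0 1) =
      of_nat DIM('a) * emeasure lborel {x \<in> ?B - {0}. sgn x \<in> sphere 0 1}"
    by (rule emeasure_sphere_measure) (metis space_sphere_measure sets.top)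
  also have "{x \<in> ?B - {0}. sgn x \<in> sphere 0 1} = ?B - {0}"
    by (auto simp: norm_sgn)
  also have "emeasure lborel (?B - {0}) = emeasure lborel ?B"
    by (rule emeasure_Diff_null_set) (auto simp: null_sets_def)
  also have "\<dots> = ennreal (unit_ball_vol DIM('a))"
    using emeasure_ball[of 1 "0 :: 'a"] by simp
  also have "of_nat DIM('a) * \<dots> = ennreal (DIM('a) * unit_ball_vol DIM('a))"
    by (simp add: ennreal_mult' ennreal_of_nat_eq_real_of_nat)
  also have "DIM('a) * unit_ball_vol DIM('a) = sphere_area DIM('a)"
  proof -
    have "Gamma (real DIM('a) / 2 + 1) = real DIM('a) / 2 * Gamma (real DIM('a) / 2)"
      by (rule Gamma_plus1) (use DIM_positive[where 'a='a] nonpos_Ints_nonpos[of "real DIM('a) / 2"] in force)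
    then show ?thesis
      unfolding unit_ball_vol_def sphere_area_def by (simp only:) simp
  qed
  finally show ?thesis .
qed

end

theory Submission
  imports Defs "HOL-Probability.Characteristic_Functions"
begin

text \<open>
  In polar coordinates, the real part of \<open>F(\<parallel>x\<parallel>) = \<integral> exp (-2\<pi>i\<langle>y,x\<rangle>) \<rho>(\<parallel>y\<parallel>) dy\<close> is the integral over
  the sphere of \<open>\<integral>\<^bsub>r>0\<^esub> r\<^bsup>d-1\<^esup> \<rho>(r) cos (2\<pi>r\<langle>x,\<xi>\<rangle>) dr\<close>. This inner integral is half the Fourier transform of the
  even function \<open>M\<^sub>d \<rho>\<close>, that is \<open>f(\<langle>x,\<xi>\<rangle>) / \<omega>\<^bsub>d-1\<^esub>\<close>, and \<open>f \<in> C\<^sub>0\<close> by the Riemann-Lebesgue lemma. If \<open>R\<^sub>d F\<close> is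
  integrable, Fourier inversion gives \<open>F\<^sub>d\<^sup>-\<^sup>1 R\<^sub>d F = R\<^sub>d \<rho>\<close> almost everywhere, so that
  averaging over almost every sphere recovers \<open>\<rho>\<close>.

  As \<open>\<rho>\<close> is only known through the Lebesgue measurable function \<open>R\<^sub>d \<rho>\<close>, it is first replaced by the
  restriction of a Borel representative of \<open>R\<^sub>d \<rho>\<close> to a ray; by Fubini almost every ray will do.
\<close>

subsection \<open>Polar coordinates\<close>

text \<open>The surface measure is a cone measure: the area of \<open>A\<close> is \<open>d\<close>
  times the volume of the cone over \<open>A\<close> in the unit ball. Polar coordinates therefore
  follow from the scaling law of Lebesgue measure and uniqueness of measures, with no
  parametrization of the sphere. The obstacle is measure theoretic: a null set of R^d may contain a
  whole ray or a whole sphere, and \<open>\<rho>\<close> is determined only up to a null set of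
  radii. Null sets are therefore moved both ways: from the space to almost every ray and almost
  every sphere, and from radii back to the space. Since \<open>F\<close> is real, nothing is lost in
  the real part; it leaves only cosines, so the cancellation of the sine part between antipodal
  points needs no separate proof. The two halves of the constant have different origins: 1/2 undoes
  the doubling of a half-line integral by the even extension, and the area of the sphere turns the
  surface measure into the uniform distribution.\<close>

definition radial_measure :: "nat \<Rightarrow> real measure" where
  "radial_measure d = density lborel (\<lambda>r. ennreal (indicator {0..} r * r ^ (d - 1)))"

lemma sets_radial_measure [simp, measurable_cong]: "sets (radial_measure d) = sets borel"
  by (simp add: radial_measure_def)

lemma space_radial_measure [simp]: "space (radial_measure d) = UNIV"
  by (simp add: radial_measure_def)

lemma emeasure_radial_measure_lessThan:
  assumes "d > 0"
  shows "emeasure (radial_measure d) {..<R} = ennreal (max 0 R ^ d / d)"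
proof -
  have "emeasure (radial_measure d) {..<R} =
      (\<integral>\<^sup>+r. ennreal (indicator {0..} r * r ^ (d - 1)) * indicator {..<R} r \<partial>lborel)"
    unfolding radial_measure_def by (subst emeasure_density) auto
  also have "\<dots> = (\<integral>\<^sup>+r. ennreal (r ^ (d - 1)) * indicator {0..max 0 R} r \<partial>lborel)"
    by (rule nn_integral_cong_AE, use AE_lborel_singleton[of R] AE_lborel_singleton[of 0] in eventually_elim)
       (auto simp: indicator_def max_def)
  also have "\<dots> = ennreal (max 0 R ^ d / d - 0 ^ d / d)"
    using assms
    by (intro nn_integral_FTC_Icc) (auto intro!: derivative_eq_intros)
  finally show ?thesis using assms by (simp add: zero_power)
qed

lemma sigma_finite_radial_measure: "d > 0 \<Longrightarrow> sigma_finite_measure (radial_measure d)"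
  unfolding sigma_finite_measure_def
  by (rule exI[of _ "range (\<lambda>n. {..<real n})"])
     (auto simp: emeasure_radial_measure_lessThan reals_Archimedean2)

lemma finite_sphere_measure: "finite_measure (sphere_measure :: 'a::euclidean_space measure)"
  by (rule finite_measureI) (simp add: emeasure_sphere_measure_sphere)

lemma sets_sphere_measureD:
  assumes "A \<in> sets (sphere_measure :: 'a::euclidean_space measure)"
  shows "A \<in> sets borel" "A \<subseteq> sphere 0 1"
  using assms by (auto simp: sets_sphere_measure sets_restrict_space_iff)

lemma measurable_ident_sphere_measure: "(\<lambda>\<xi>. \<xi>) \<in> sphere_measure \<rightarrow>\<^sub>M borel"
  by (simp add: measurable_cong_sets[OF sets_sphere_measure refl] measurable_restrict_space1)

lemma measurable_sphere_measure: "f \<in> borel \<rightarrow>\<^sub>M M \<Longrightarrow> f \<in> sphere_measure \<rightarrow>\<^sub>M M"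
  by (rule measurable_compose[OF measurable_ident_sphere_measure])

lemma emeasure_lborel_scale:
  fixes S :: "'a::euclidean_space set"
  assumes "S \<in> sets borel" "c > 0"
  shows "emeasure lborel S = ennreal (c ^ DIM('a)) * emeasure lborel {x. c *\<^sub>R x \<in> S}"
proof -
  have [measurable]: "S \<in> sets borel" by fact
  have "emeasure lborel S =
      emeasure (density (distr lborel borel (\<lambda>x. 0 + c *\<^sub>R x)) (\<lambda>_. \<bar>c\<bar> ^ DIM('a))) S"
    using lborel_affine[of c "0 :: 'a"] assms by simp
  also have "\<dots> = ennreal (c ^ DIM('a)) * emeasure lborel {x. c *\<^sub>R x \<in> S}"
    using assms by (simp add: emeasure_density nn_integral_cmult_indicator emeasure_distr vimage_def)
  finally show ?thesis .
qed

text \<open>For fixed \<open>A\<close> both sides are measures in \<open>B\<close>, so it suffices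
  to compare them on the generator of sets \<open>{..<R}\<close>. There the cone over
  \<open>A\<close> cut off at radius \<open>R\<close> is the \<open>R\<close>-dilate of the cone
  that defines the surface measure, which contributes \<open>R ^ d\<close>, while the radial measure
  of \<open>{..<R}\<close> is \<open>R ^ d / d\<close>; the remaining factor \<open>d\<close> is the
  one in the definition of the surface measure.\<close>

lemma emeasure_polar_rectangle:
  assumes A: "A \<in> sets (sphere_measure :: 'a::euclidean_space measure)" and B: "B \<in> sets borel"
  shows "emeasure lborel {x :: 'a. x \<noteq> 0 \<and> sgn x \<in> A \<and> norm x \<in> B} =
    emeasure sphere_measure A * emeasure (radial_measure DIM('a)) B"
proof -
  let ?d = "DIM('a)"
  define C where "C = {x :: 'a. x \<noteq> 0 \<and> sgn x \<in> A}"
  have [measurable]: "(sgn :: 'a \<Rightarrow> 'a) \<in> borel_measurable borel"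
    unfolding sgn_div_norm[abs_def] by measurable
  have [measurable]: "A \<in> sets borel" "B \<in> sets borel"
    using A B by (auto dest: sets_sphere_measureD)
  have [measurable]: "C \<in> sets borel" unfolding C_def by measurable
  define M where "M = distr (density lborel (indicator C)) borel (norm :: 'a \<Rightarrow> real)"
  define N where "N = scale_measure (emeasure sphere_measure A) (radial_measure ?d)"
  have M: "emeasure M X = emeasure lborel {x. x \<in> C \<and> norm x \<in> X}" if [measurable]: "X \<in> sets borel" for X
  proof -
    have [measurable]: "norm -` X \<in> sets (borel :: 'a measure)"
      using measurable_sets[of norm "borel :: 'a measure" borel X] that by simp
    have "emeasure M X = emeasure lborel (C \<inter> norm -` X)"
      unfolding M_def
      by (subst emeasure_distr) (auto simp: emeasure_restricted)
    also have "C \<inter> norm -` X = {x. x \<in> C \<and> norm x \<in> X}" by auto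
    finally show ?thesis .
  qed
  have eq: "emeasure M {..<R} = emeasure N {..<R}" for R
  proof (cases "R > 0")
    case False
    then have "\<not> norm x < R" for x :: 'a
      using norm_ge_zero[of x] by linarith
    then have "{x. x \<in> C \<and> norm x \<in> {..<R}} = {}" by auto
    then have "emeasure M {..<R} = 0"
      by (simp only: M[OF lessThan_borel] emeasure_empty)
    then show ?thesis using False
      by (simp add: N_def emeasure_radial_measure_lessThan zero_power)
  next
    case True
    have "emeasure M {..<R} = ennreal (R ^ ?d) * emeasure lborel {x. R *\<^sub>R x \<in> {x. x \<in> C \<and> norm x \<in> {..<R}}}"
      unfolding M[OF lessThan_borel] using True by (intro emeasure_lborel_scale) auto
    also have "{x. R *\<^sub>R x \<in> {x. x \<in> C \<and> norm x \<in> {..<R}}} = {x \<in> ball 0 1 - {0}. sgn x \<in> A}"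
      using True by (auto simp: C_def sgn_scaleR)
    also have "ennreal (R ^ ?d) * emeasure lborel \<dots> =
        (of_nat ?d * emeasure lborel {x \<in> ball 0 1 - {0}. sgn x \<in> A}) * ennreal (R ^ ?d / ?d)"
    proof -
      have "ennreal (R ^ ?d) = of_nat ?d * ennreal (R ^ ?d / ?d)"
        using True by (simp add: ennreal_of_nat_eq_real_of_nat flip: ennreal_mult')
      then show ?thesis by (simp only: mult_ac)
    qed
    also have "\<dots> = emeasure N {..<R}"
      using True by (simp add: N_def emeasure_radial_measure_lessThan emeasure_sphere_measure[OF A])
    finally show ?thesis .
  qed
  have "M = N"
  proof (rule measure_eqI_generator_eq[where E = "range lessThan" and \<Omega> = UNIV and A = "\<lambda>n. {..<real n}"])
    show "Int_stable (range lessThan :: real set set)"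
    proof (rule Int_stableI)
      fix A B :: "real set" assume "A \<in> range lessThan" "B \<in> range lessThan"
      then obtain a b where "A = {..<a}" "B = {..<b}" by auto
      then have "A \<inter> B = {..<min a b}" by auto
      then show "A \<inter> B \<in> range lessThan" by blast
    qed
    show "emeasure M X = emeasure N X" if "X \<in> range lessThan" for X
      using that eq by auto
    show "sets M = sigma_sets UNIV (range lessThan)" "sets N = sigma_sets UNIV (range lessThan)"
      by (simp_all add: M_def N_def borel_Iio)
    show "emeasure M {..<real n} \<noteq> \<infinity>" for n
      unfolding eq using finite_measure.emeasure_finite[OF finite_sphere_measure, of A]
      by (auto simp: N_def emeasure_radial_measure_lessThan ennreal_mult_eq_top_iff)
  qed (auto simp: reals_Archimedean2)
  then have "emeasure M B = emeasure N B" by simp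
  then show ?thesis by (simp add: M N_def C_def conj_assoc)
qed

lemma measurable_polar [measurable]:
  "(\<lambda>(\<xi>, r). r *\<^sub>R \<xi>) \<in> (sphere_measure :: 'a::euclidean_space measure) \<Otimes>\<^sub>M radial_measure d \<rightarrow>\<^sub>M borel"
proof -
  have "(\<lambda>p. fst p) \<in> (sphere_measure :: 'a measure) \<Otimes>\<^sub>M radial_measure d \<rightarrow>\<^sub>M borel"
    by (rule measurable_compose[OF measurable_fst measurable_ident_sphere_measure])
  then show ?thesis unfolding split_beta' by measurable
qed

text \<open>The product measure is identified as the image of \<open>lborel\<close> under the
  inverse map \<open>T\<close>, since the two agree on rectangles. Composing with the polar map then
  gives the identity.\<close>

theorem polar_lborel:
  "distr (sphere_measure \<Otimes>\<^sub>M radial_measure DIM('a)) borel (\<lambda>(\<xi>, r). r *\<^sub>R \<xi>)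
     = (lborel :: 'a::euclidean_space measure)"
proof -
  let ?P = "(sphere_measure :: 'a measure) \<Otimes>\<^sub>M radial_measure DIM('a)"
  define e :: 'a where "e = (SOME b. b \<in> Basis)"
  have e: "norm e = 1" unfolding e_def by (simp add: some_in_eq)
  \<comment> \<open>The origin has no direction. The unit vector \<open>e\<close> keeps the first
    component on the sphere, and radius 0 makes the polar map a left inverse of \<open>T\<close> at
    the origin too.\<close>
  define T where "T x = (if x = 0 then (e, 0) else (sgn x, norm x))" for x :: 'a
  have [measurable]: "(sgn :: 'a \<Rightarrow> 'a) \<in> borel_measurable borel"
    unfolding sgn_div_norm[abs_def] by measurable
  have "(\<lambda>x. if x = 0 then e else sgn x) \<in> borel \<rightarrow>\<^sub>M restrict_space borel (sphere 0 1)"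
    by (intro measurable_restrict_space2) (auto simp: norm_sgn e)
  then have 1: "(\<lambda>x. if x = 0 then e else sgn x) \<in> borel \<rightarrow>\<^sub>M sphere_measure"
    by (simp add: measurable_cong_sets[OF refl sets_sphere_measure])
  have "T = (\<lambda>x. (if x = 0 then e else sgn x, norm x))"
    by (auto simp: T_def)
  then have T[measurable]: "T \<in> borel \<rightarrow>\<^sub>M ?P"
    using 1 by simp
  have "?P = distr lborel ?P T"
  proof (rule pair_measure_eqI)
    show "sigma_finite_measure (sphere_measure :: 'a measure)"
      by (rule finite_measure.axioms(1)[OF finite_sphere_measure])
    show "sigma_finite_measure (radial_measure DIM('a))"
      by (rule sigma_finite_radial_measure) simp
    fix A B assume A: "A \<in> sets (sphere_measure :: 'a measure)" and B: "B \<in> sets (radial_measure DIM('a))"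
    have [measurable]: "A \<in> sets borel" "B \<in> sets borel"
      using A B by (auto dest: sets_sphere_measureD)
    have "emeasure (distr lborel ?P T) (A \<times> B) = emeasure lborel (T -` (A \<times> B))"
      using A B by (subst emeasure_distr) auto
    also have "\<dots> = emeasure lborel {x :: 'a. x \<noteq> 0 \<and> sgn x \<in> A \<and> norm x \<in> B}"
    proof (rule emeasure_eq_AE)
      show "AE x in lborel. (x \<in> T -` (A \<times> B)) = (x \<in> {x :: 'a. x \<noteq> 0 \<and> sgn x \<in> A \<and> norm x \<in> B})"
        using AE_lborel_singleton[of "0 :: 'a"] by eventually_elim (auto simp: T_def)
      show "T -` (A \<times> B) \<in> sets lborel"
        using measurable_sets[OF T, of "A \<times> B"] A B by auto
    qed measurable
    finally show "emeasure sphere_measure A * emeasure (radial_measure DIM('a)) B =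
        emeasure (distr lborel ?P T) (A \<times> B)"
      using A B by (simp add: emeasure_polar_rectangle)
  qed simp
  then have "distr ?P borel (\<lambda>(\<xi>, r). r *\<^sub>R \<xi>) = distr (distr lborel ?P T) borel (\<lambda>(\<xi>, r). r *\<^sub>R \<xi>)"
    by simp
  also have "\<dots> = distr lborel borel ((\<lambda>(\<xi>, r). r *\<^sub>R \<xi>) \<circ> T)"
    by (rule distr_distr[OF measurable_polar]) simp
  also have "(\<lambda>(\<xi>, r). r *\<^sub>R \<xi>) \<circ> T = (\<lambda>x. x)"
    by (auto simp: T_def sgn_div_norm fun_eq_iff)
  also have "distr lborel borel (\<lambda>x :: 'a. x) = lborel"
    by (rule distr_id2) simp
  finally show ?thesis .
qed


section \<open>Null sets and integrals in polar coordinates\<close>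

lemma pair_sigma_finite_polar:
  "pair_sigma_finite (sphere_measure :: 'a::euclidean_space measure) (radial_measure DIM('a))"
  unfolding pair_sigma_finite_def
  by (simp add: sigma_finite_radial_measure finite_measure.axioms(1)[OF finite_sphere_measure])

lemma sphere_area_pos: "d > 0 \<Longrightarrow> sphere_area d > 0"
  by (simp add: sphere_area_def Gamma_real_pos)

lemma measure_sphere_measure_sphere:
  "measure (sphere_measure :: 'a::euclidean_space measure) (sphere 0 1) = sphere_area DIM('a)"
  using sphere_area_pos[OF DIM_positive[where 'a = 'a]]
  by (simp add: measure_def emeasure_sphere_measure_sphere)

text \<open>A property of almost every direction thus holds for at least one, which allows a single
  good ray to be picked.\<close>

lemma ae_filter_sphere_measure:
  "ae_filter (sphere_measure :: 'a::euclidean_space measure) \<noteq> bot"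
  using sphere_area_pos[OF DIM_positive[where 'a = 'a]]
  by (simp add: ae_filter_eq_bot_iff emeasure_sphere_measure_sphere)

lemma AE_radial_measure:
  assumes "AE r in radial_measure d. P r"
  shows "AE r in lborel. r > 0 \<longrightarrow> P r"
proof -
  have "AE r in lborel. ennreal (indicator {0..} r * r ^ (d - 1)) > 0 \<longrightarrow> P r"
    using assms unfolding radial_measure_def by (subst (asm) AE_density) auto
  then show ?thesis by eventually_elim auto
qed

text \<open>Fubini for the polar product measure, in both orders. The version for rays supplies the
  ray that defines the Borel representative, the version for spheres is what the averaging operator
  needs.\<close>

lemma AE_polar:
  assumes N: "N \<in> null_sets (lborel :: 'a::euclidean_space measure)"
  shows "AE \<xi> in sphere_measure. AE r in lborel. r > 0 \<longrightarrow> r *\<^sub>R \<xi> \<notin> N"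
    and "AE r in lborel. r > 0 \<longrightarrow> (AE \<xi> in sphere_measure. r *\<^sub>R \<xi> \<notin> N)"
proof -
  let ?P = "(sphere_measure :: 'a measure) \<Otimes>\<^sub>M radial_measure DIM('a)"
  interpret pair_sigma_finite "sphere_measure :: 'a measure" "radial_measure DIM('a)"
    by (rule pair_sigma_finite_polar)
  have [measurable]: "N \<in> sets borel" using N by auto
  have "AE x in lborel. x \<notin> N" using N by (rule AE_not_in)
  then have "AE p in ?P. (case p of (\<xi>, r) \<Rightarrow> r *\<^sub>R \<xi>) \<notin> N"
    by (subst (asm) polar_lborel[symmetric], subst (asm) AE_distr_iff) auto
  then have 1: "AE \<xi> in sphere_measure. AE r in radial_measure DIM('a). r *\<^sub>R \<xi> \<notin> N"
    by (drule_tac AE_pair) simp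
  have "{p \<in> space ?P. (case p of (\<xi>, r) \<Rightarrow> r *\<^sub>R \<xi>) \<notin> N} \<in> sets ?P"
    by measurable
  then have "{p \<in> space ?P. snd p *\<^sub>R fst p \<notin> N} \<in> sets ?P"
    by (simp add: split_beta')
  then have 2: "AE r in radial_measure DIM('a). AE \<xi> in sphere_measure. r *\<^sub>R \<xi> \<notin> N"
    using 1 by (subst AE_commute[symmetric]) auto
  show "AE \<xi> in sphere_measure. AE r in lborel. r > 0 \<longrightarrow> r *\<^sub>R \<xi> \<notin> N"
    using 1 by eventually_elim (rule AE_radial_measure)
  show "AE r in lborel. r > 0 \<longrightarrow> (AE \<xi> in sphere_measure. r *\<^sub>R \<xi> \<notin> N)"
    using 2 by (rule AE_radial_measure)
qed

text \<open>This is the way back from radii to the space: the radial measure is absolutely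
  continuous, so a null set of radii is null for it, and so is its product with all directions. On
  the type \<open>real\<close> the lemma extends a statement about almost all positive numbers
  evenly to the negative ones.\<close>

lemma AE_norm:
  assumes "AE r in lborel. r > 0 \<longrightarrow> P r"
  shows "AE x in (lborel :: 'a::euclidean_space measure). x \<noteq> 0 \<longrightarrow> P (norm x)"
proof -
  interpret pair_sigma_finite "sphere_measure :: 'a measure" "radial_measure DIM('a)"
    by (rule pair_sigma_finite_polar)
  from assms obtain N where N: "{r. \<not> (r > 0 \<longrightarrow> P r)} \<subseteq> N" "N \<in> null_sets lborel"
    by (auto elim: AE_E2 simp: eventually_ae_filter)
  then have [measurable]: "N \<in> sets borel" by auto
  have "N \<in> null_sets (radial_measure DIM('a))"
    using AE_not_in[OF N(2)] unfolding radial_measure_def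
    by (subst null_sets_density_iff) (auto elim: eventually_mono)
  then have "AE r in radial_measure DIM('a). r \<notin> N" by (rule AE_not_in)
  moreover have "{p \<in> space (sphere_measure \<Otimes>\<^sub>M radial_measure DIM('a)). norm (case p of (\<xi> :: 'a, r) \<Rightarrow> r *\<^sub>R \<xi>) \<notin> N - {..0}} \<in> sets (sphere_measure \<Otimes>\<^sub>M radial_measure DIM('a))"
    by measurable
  ultimately have "AE p in sphere_measure \<Otimes>\<^sub>M radial_measure DIM('a). norm (case p of (\<xi> :: 'a, r) \<Rightarrow> r *\<^sub>R \<xi>) \<notin> N - {..0}"
  proof (intro AE_pair_measure)
    \<comment> \<open>The norm of \<open>r *\<^sub>R \<xi>\<close> is the absolute value of
      \<open>r\<close>, so \<open>r \<notin> N\<close> says something about it only for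
      \<open>r \<ge> 0\<close>. The radial measure does not charge the rest.\<close>
    have "AE r in radial_measure DIM('a). r \<ge> 0"
      unfolding radial_measure_def by (subst AE_density) (auto simp: indicator_def intro!: AE_I2)
    with \<open>AE r in radial_measure DIM('a). r \<notin> N\<close>
    have *: "AE r in radial_measure DIM('a). r \<notin> N \<and> r \<ge> 0" by auto
    show "AE \<xi> in (sphere_measure :: 'a measure). AE r in radial_measure DIM('a). norm (case (\<xi>, r) of (\<xi>, r) \<Rightarrow> r *\<^sub>R \<xi>) \<notin> N - {..0}"
    proof (rule AE_I2)
      fix \<xi> :: 'a assume "\<xi> \<in> space sphere_measure"
      then have "norm \<xi> = 1" by simp
      show "AE r in radial_measure DIM('a). norm (case (\<xi>, r) of (\<xi>, r) \<Rightarrow> r *\<^sub>R \<xi>) \<notin> N - {..0}"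
        using * by (rule eventually_mono) (simp add: \<open>norm \<xi> = 1\<close>)
    qed
  qed
  then have "AE x in (lborel :: 'a measure). norm x \<notin> N - {..0}"
    by (subst polar_lborel[symmetric], subst AE_distr_iff) auto
  then show ?thesis
  proof eventually_elim
    case (elim x)
    show ?case
    proof
      assume "x \<noteq> 0"
      with elim have "norm x \<notin> N" by simp
      then have "norm x \<notin> {r. \<not> (r > 0 \<longrightarrow> P r)}" by (rule contra_subsetD[OF N(1)])
      with \<open>x \<noteq> 0\<close> show "P (norm x)" by simp
    qed
  qed
qed

lemma integrable_polar:
  fixes h :: "'a::euclidean_space \<Rightarrow> 'b::{banach, second_countable_topology}"
  assumes "integrable lborel h"
  shows "integrable (sphere_measure \<Otimes>\<^sub>M radial_measure DIM('a)) (\<lambda>(\<xi>, r). h (r *\<^sub>R \<xi>))"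
proof -
  have "h \<in> borel_measurable borel" using assms by auto
  then show ?thesis
    using assms by (subst (asm) polar_lborel[symmetric], subst (asm) integrable_distr_eq) (auto simp: split_beta')
qed

lemma integral_radial_measure:
  fixes h :: "real \<Rightarrow> 'b::{banach, second_countable_topology}"
  assumes [measurable]: "h \<in> borel_measurable borel"
  shows "integral\<^sup>L (radial_measure d) h = (LINT r|lborel. (indicator {0..} r * r ^ (d - 1)) *\<^sub>R h r)"
    and "integrable (radial_measure d) h \<longleftrightarrow> integrable lborel (\<lambda>r. (indicator {0..} r * r ^ (d - 1)) *\<^sub>R h r)"
  unfolding radial_measure_def
  by (subst integral_density integrable_density; auto simp: indicator_def)+

lemma integral_polar:
  fixes h :: "'a::euclidean_space \<Rightarrow> 'b::{banach, second_countable_topology}"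
  assumes h: "integrable lborel h"
  shows "integral\<^sup>L lborel h =
    (LINT \<xi>|sphere_measure. LINT r|lborel. (indicator {0..} r * r ^ (DIM('a) - 1)) *\<^sub>R h (r *\<^sub>R \<xi>))"
proof -
  interpret pair_sigma_finite "sphere_measure :: 'a measure" "radial_measure DIM('a)"
    by (rule pair_sigma_finite_polar)
  have [measurable]: "h \<in> borel_measurable borel" using h by auto
  have "integral\<^sup>L lborel h = (LINT p|(sphere_measure \<Otimes>\<^sub>M radial_measure DIM('a)). h (case p of (\<xi>, r) \<Rightarrow> r *\<^sub>R \<xi>))"
    by (subst polar_lborel[symmetric], subst integral_distr) auto
  also have "\<dots> = (LINT \<xi>|sphere_measure. LINT r|radial_measure DIM('a). h (r *\<^sub>R \<xi>))"
    using integral_fst'[OF integrable_polar[OF h]] by (simp add: split_beta')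
  also have "\<dots> = (LINT \<xi>|sphere_measure. LINT r|lborel. (indicator {0..} r * r ^ (DIM('a) - 1)) *\<^sub>R h (r *\<^sub>R \<xi>))"
    by (intro Bochner_Integration.integral_cong refl integral_radial_measure) measurable
  finally show ?thesis .
qed

text \<open>By Fubini the function is integrable along almost every ray. Along each ray it is the
  same function of \<open>r\<close>, so one ray decides.\<close>

lemma integrable_radial:
  fixes p :: "real \<Rightarrow> real"
  assumes [measurable]: "p \<in> borel_measurable borel"
    and int: "integrable lborel (\<lambda>x :: 'a::euclidean_space. p (norm x))"
  shows "integrable lborel (\<lambda>r. indicator {0..} r * r ^ (DIM('a) - 1) * p r)"
proof -
  interpret pair_sigma_finite "sphere_measure :: 'a measure" "radial_measure DIM('a)"
    by (rule pair_sigma_finite_polar)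
  have "AE \<xi> in (sphere_measure :: 'a measure). integrable (radial_measure DIM('a)) (\<lambda>r. p (norm (r *\<^sub>R \<xi>)))"
    using AE_integrable_fst'[OF integrable_polar[OF int]] by simp
  then have "AE \<xi> in (sphere_measure :: 'a measure). integrable (radial_measure DIM('a)) (\<lambda>r. p \<bar>r\<bar>)"
    using AE_space by eventually_elim simp
  then have "integrable (radial_measure DIM('a)) (\<lambda>r. p \<bar>r\<bar>)"
    using eventually_happens'[OF ae_filter_sphere_measure] by blast
  then have "integrable lborel (\<lambda>r. indicator {0..} r * r ^ (DIM('a) - 1) * p \<bar>r\<bar>)"
    by (subst (asm) integral_radial_measure(2)) auto
  then show ?thesis
    by (rule Bochner_Integration.integrable_cong[THEN iffD1, rotated 2]) (auto simp: indicator_def)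
qed

text \<open>The Borel version \<open>G\<close> of the rotated function need not be radial. Its
  restriction \<open>p\<close> to one ray, composed with the norm, is both Borel and radial;
  \<open>AE_norm\<close> shows that it still represents the original function on the whole
  space.\<close>

lemma radial_borel_representative:
  fixes \<rho> :: "real \<Rightarrow> real"
  assumes rho: "integrable lebesgue (\<lambda>x :: 'a::euclidean_space. \<rho> (norm x))"
  obtains p where "p \<in> borel_measurable borel" "AE r in lborel. r > 0 \<longrightarrow> \<rho> r = p r"
    "AE x in (lborel :: 'a measure). \<rho> (norm x) = p (norm x)"
    "integrable lborel (\<lambda>x :: 'a. p (norm x))"
proof -
  obtain G where G: "G \<in> borel_measurable lborel" "AE x :: 'a in lborel. \<rho> (norm x) = G x"
    using completion_ex_borel_measurable_real[OF borel_measurable_integrable[OF rho]] by auto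
  then obtain N where N: "N \<in> null_sets lborel" "{x. \<rho> (norm x) \<noteq> G x} \<subseteq> N"
    by (auto simp: eventually_ae_filter)
  obtain \<xi> where \<xi>: "norm \<xi> = 1" and AE: "AE r in lborel. r > 0 \<longrightarrow> r *\<^sub>R \<xi> \<notin> N"
    using eventually_happens'[OF ae_filter_sphere_measure eventually_conj[OF AE_polar(1)[OF N(1)] AE_space]]
    by auto
  define p where "p r = G (r *\<^sub>R \<xi>)" for r
  have [measurable]: "G \<in> borel_measurable borel" using G by simp
  have p[measurable]: "p \<in> borel_measurable borel" unfolding p_def by measurable
  have eq: "AE r in lborel. r > 0 \<longrightarrow> \<rho> r = p r"
    using AE
  proof eventually_elim
    case (elim r)
    show ?case
    proof
      assume r: "r > 0"
      then have "\<rho> (norm (r *\<^sub>R \<xi>)) = G (r *\<^sub>R \<xi>)" using N elim by blast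
      then show "\<rho> r = p r" using r \<xi> by (simp add: p_def)
    qed
  qed
  have eq2: "AE x in (lborel :: 'a measure). \<rho> (norm x) = p (norm x)"
    using AE_norm[OF eq] AE_lborel_singleton[of 0] by eventually_elim auto
  have "integrable lebesgue (\<lambda>x :: 'a. p (norm x))"
    using rho by (rule integrable_cong_AE_imp) (use AE_completion[OF eq2] in \<open>auto intro: measurable_completion\<close>)
  then have "integrable lborel (\<lambda>x :: 'a. p (norm x))"
    by (subst (asm) integrable_completion) auto
  with p eq eq2 show ?thesis by (rule that)
qed

subsection \<open>The Riemann-Lebesgue lemma\<close>

lemma continuous_integral:
  fixes h :: "'s::metric_space \<Rightarrow> 'x \<Rightarrow> 'b::{banach, second_countable_topology}"
  assumes meas: "\<And>s. h s \<in> borel_measurable M" and w: "integrable M w"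
    and bound: "\<And>s x. norm (h s x) \<le> w x"
    and cont: "\<And>x. continuous_on UNIV (\<lambda>s. h s x)"
  shows "continuous_on UNIV (\<lambda>s. LINT x|M. h s x)"
  unfolding continuous_on_sequentially
proof (intro allI ballI impI, elim conjE)
  fix s and u :: "nat \<Rightarrow> 's" assume u: "u \<longlonglongrightarrow> s"
  have "(\<lambda>n. LINT x|M. h (u n) x) \<longlonglongrightarrow> (LINT x|M. h s x)"
  proof (rule integral_dominated_convergence[where w = w])
    show "AE x in M. (\<lambda>n. h (u n) x) \<longlonglongrightarrow> h s x"
      using cont u by (auto simp: continuous_on_sequentially o_def)
  qed (use meas w bound in auto)
  then show "((\<lambda>s. LINT x|M. h s x) \<circ> u) \<longlonglongrightarrow> (LINT x|M. h s x)"
    by (simp add: o_def)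
qed

text \<open>Applied to a weight that vanishes on negative numbers, this is the inner radial
  integral. The factor \<open>2 * pi\<close> is left to the argument, where it does not affect the
  limit at infinity.\<close>

definition cos_transform :: "(real \<Rightarrow> real) \<Rightarrow> real \<Rightarrow> real" where
  "cos_transform f s = (LINT r|lborel. f r * cos (s * r))"

lemma integrable_mult_cos:
  fixes f :: "real \<Rightarrow> real"
  shows "integrable lborel f \<Longrightarrow> integrable lborel (\<lambda>r. f r * cos (s * r))"
  by (rule Bochner_Integration.integrable_bound[where f = f]) (auto simp: abs_mult mult_left_le)

text \<open>The transforms of two functions differ at every \<open>s\<close> by at most their L1
  distance. One good approximation therefore serves all large \<open>s\<close> at once.\<close>

lemma cos_transform_tendsto_0_closed:
  assumes f: "integrable lborel f" and g: "\<And>k. integrable lborel (g k)"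
    and lim: "\<And>k. (cos_transform (g k) \<longlongrightarrow> 0) at_infinity"
    and L1: "(\<lambda>k. LINT r|lborel. \<bar>f r - g k r\<bar>) \<longlonglongrightarrow> 0"
  shows "(cos_transform f \<longlongrightarrow> 0) at_infinity"
proof (rule tendstoI)
  fix e :: real assume e: "e > 0"
  from L1 e obtain k where k: "(LINT r|lborel. \<bar>f r - g k r\<bar>) < e / 2"
    using eventually_happens[OF order_tendstoD(2)[OF L1, of "e/2"]] by auto
  have "\<forall>\<^sub>F s in at_infinity. dist (cos_transform (g k) s) 0 < e / 2"
    using lim e by (intro tendstoD) auto
  then show "\<forall>\<^sub>F s in at_infinity. dist (cos_transform f s) 0 < e"
  proof eventually_elim
    case (elim s)
    have "cos_transform f s - cos_transform (g k) s = (LINT r|lborel. (f r - g k r) * cos (s * r))"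
      unfolding cos_transform_def left_diff_distrib
      using f g by (intro Bochner_Integration.integral_diff[symmetric] integrable_mult_cos)
    also have "\<bar>\<dots>\<bar> \<le> (LINT r|lborel. \<bar>(f r - g k r) * cos (s * r)\<bar>)"
      by (rule integral_abs_bound)
    also have "\<dots> \<le> (LINT r|lborel. \<bar>f r - g k r\<bar>)"
      using f g by (intro integral_mono integrable_abs integrable_mult_cos)
        (auto simp: abs_mult mult_left_le)
    finally show ?case using k elim by simp
  qed
qed

text \<open>The constant 2 is the one in the limit case of \<open>integrable_induct\<close>.\<close>

lemma cos_transform_tendsto_0_dominated:
  assumes f: "integrable lborel f" and g: "\<And>k. integrable lborel (g k)"
    and lim: "\<And>k. (cos_transform (g k) \<longlongrightarrow> 0) at_infinity"
    and ptw: "\<And>r. (\<lambda>k. g k r) \<longlonglongrightarrow> f r" and dom: "\<And>k r. \<bar>g k r\<bar> \<le> 2 * \<bar>f r\<bar>"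
  shows "(cos_transform f \<longlongrightarrow> 0) at_infinity"
proof (rule cos_transform_tendsto_0_closed[OF f g lim])
  have [measurable]: "f \<in> borel_measurable borel" "g k \<in> borel_measurable borel" for k
    using f g by (auto dest: borel_measurable_integrable)
  have "(\<lambda>k. LINT r|lborel. \<bar>f r - g k r\<bar>) \<longlonglongrightarrow> (LINT (r::real)|lborel. (0::real))"
  \<comment> \<open>The triangle inequality gives 3 = 1 + 2, with the 2 from the bound on
    \<open>g k\<close>.\<close>
  proof (rule integral_dominated_convergence[where w = "\<lambda>r. 3 * \<bar>f r\<bar>"])
    show "AE r in lborel. (\<lambda>k. \<bar>f r - g k r\<bar>) \<longlonglongrightarrow> 0"
      using tendsto_rabs[OF tendsto_diff[OF tendsto_const ptw], of "f r" r for r] by (intro AE_I2) auto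
    show "AE r in lborel. norm \<bar>f r - g k r\<bar> \<le> 3 * \<bar>f r\<bar>" for k
      using dom[of k] by (intro AE_I2) (smt (verit) real_norm_def)
  qed (use f in auto)
  then show "(\<lambda>k. LINT r|lborel. \<bar>f r - g k r\<bar>) \<longlonglongrightarrow> 0" by simp
qed

text \<open>The primitive \<open>sin (s * r) / s\<close> is available, so the transform is at most
  \<open>2 / \<bar>s\<bar>\<close> in absolute value.\<close>

lemma cos_transform_Icc_tendsto_0:
  "(cos_transform (indicator {a..b}) \<longlongrightarrow> 0) at_infinity"
proof (cases "a \<le> b")
  case False
  then show ?thesis by (simp add: cos_transform_def[abs_def])
next
  case True
  have *: "\<forall>\<^sub>F s :: real in at_infinity. s \<noteq> 0"
    by (auto simp: eventually_at_infinity intro!: exI[of _ 1])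
  have bnd: "norm (cos_transform (indicator {a..b}) s) \<le> 2 * norm (inverse s)" if s: "s \<noteq> 0" for s
  proof -
    have "cos_transform (indicator {a..b}) s = (LINT r|lborel. cos (s * r) * indicator {a..b} r)"
      by (simp add: cos_transform_def mult.commute)
    also have "\<dots> = sin (s * b) / s - sin (s * a) / s"
      using s by (intro integral_FTC_Icc_real True) (auto intro!: derivative_eq_intros)
    also have "\<dots> = (sin (s * b) - sin (s * a)) * inverse s" by (simp add: divide_inverse left_diff_distrib)
    also have "norm \<dots> \<le> 2 * norm (inverse s)"
      unfolding norm_mult
      using sin_le_one[of "s * a"] sin_le_one[of "s * b"] sin_ge_minus_one[of "s * a"] sin_ge_minus_one[of "s * b"]
      by (intro mult_right_mono norm_ge_zero) (unfold real_norm_def abs_le_iff, linarith)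
    finally show ?thesis .
  qed
  have "((\<lambda>s :: real. 2 * norm (inverse s)) \<longlongrightarrow> 2 * 0) at_infinity"
    by (intro tendsto_intros tendsto_norm_zero tendsto_inverse_0)
  then have "((\<lambda>s :: real. 2 * norm (inverse s)) \<longlongrightarrow> 0) at_infinity" by simp
  then show ?thesis
    by (rule Lim_null_comparison[rotated]) (use * in eventually_elim, rule bnd)
qed

text \<open>A Dynkin argument: the sets \<open>A\<close> with this property contain the half-lines,
  whose truncations are intervals, and are closed under complements and disjoint unions. The fixed
  window \<open>{-m..m}\<close> keeps complements integrable.\<close>

lemma cos_transform_bounded_set_tendsto_0:
  fixes m :: real
  assumes "A \<in> sets borel"
  shows "(cos_transform (indicator (A \<inter> {-m..m})) \<longlongrightarrow> 0) at_infinity"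
proof -
  let ?I = "{-m..m}"
  have int: "integrable lborel (indicator (B \<inter> ?I) :: real \<Rightarrow> real)" if "B \<in> sets borel" for B
  proof -
    have "emeasure lborel (B \<inter> ?I) \<le> emeasure lborel ?I"
      using that by (intro emeasure_mono) auto
    also have "\<dots> < \<infinity>" by (simp add: emeasure_lborel_Icc_eq)
    finally show ?thesis using that by (simp add: integrable_indicator_iff)
  qed
  have "Int_stable (range atMost :: real set set)"
  proof (rule Int_stableI)
    fix A B :: "real set" assume "A \<in> range atMost" "B \<in> range atMost"
    then obtain a b where "A = {..a}" "B = {..b}" by auto
    then have "A \<inter> B = {..min a b}" by auto
    then show "A \<inter> B \<in> range atMost" by blast
  qed
  moreover have "range atMost \<subseteq> Pow (UNIV :: real set)" by simp
  moreover have "A \<in> sigma_sets UNIV (range atMost)"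
    using assms by (simp add: borel_eq_atMost)
  ultimately show ?thesis
  proof (induction rule: sigma_sets_induct_disjoint)
    case (basic B)
    then obtain c where "B = {..c}" by auto
    then have "B \<inter> ?I = {-m..min c m}" by auto
    then show ?case by (simp add: cos_transform_Icc_tendsto_0)
  next
    case empty
    show ?case by (simp add: cos_transform_def[abs_def])
  next
    case (compl B)
    then have B: "B \<in> sets borel" by (simp add: borel_eq_atMost)
    have eq: "cos_transform (indicator ((UNIV - B) \<inter> ?I)) s =
        cos_transform (indicator ?I) s - cos_transform (indicator (B \<inter> ?I)) s" for s
    proof -
      have "indicator ((UNIV - B) \<inter> ?I) r * cos (s * r) =
          indicator ?I r * cos (s * r) - indicator (B \<inter> ?I) r * cos (s * r)" for r
        by (auto simp: indicator_def)
      then show ?thesis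
        unfolding cos_transform_def
        using int[OF B] int[of UNIV]
        by (simp add: integrable_mult_cos flip: Bochner_Integration.integral_diff)
    qed
    show ?case
      unfolding eq using tendsto_diff[OF cos_transform_Icc_tendsto_0 compl(2), of "-m" m] by simp
  next
    case (union B)
    have B[measurable]: "B i \<in> sets borel" for i using union by (auto simp: borel_eq_atMost)
    show ?case
    proof (rule cos_transform_tendsto_0_dominated[where g = "\<lambda>k r. \<Sum>i<k. indicator (B i \<inter> ?I) r"])
      \<comment> \<open>Disjointness makes the partial sum an indicator again, so it is dominated by
        the indicator of the full union.\<close>
      have eq: "(\<Sum>i<k. indicator (B i \<inter> ?I) r) = (indicator ((\<Union>i<k. B i) \<inter> ?I) r :: real)" for k r
      proof -
        have "disjoint_family_on (\<lambda>i. B i \<inter> ?I) {..<k}"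
          using union(1) by (auto simp: disjoint_family_on_def)
        then show ?thesis
          by (subst indicator_UN_disjoint[symmetric]) (auto intro!: arg_cong2[where f=indicator])
      qed
      show "\<bar>\<Sum>i<k. indicator (B i \<inter> ?I) r\<bar> \<le> 2 * \<bar>indicator (\<Union> (range B) \<inter> ?I) r :: real\<bar>" for k r
        unfolding eq by (auto simp: indicator_def)
      show "(\<lambda>k. \<Sum>i<k. indicator (B i \<inter> ?I) r) \<longlonglongrightarrow> (indicator (\<Union> (range B) \<inter> ?I) r :: real)" for r
      proof (unfold eq, cases "r \<in> (\<Union> (range B))")
        case True
        then obtain i where "r \<in> B i" by auto
        then have "\<forall>\<^sub>F k in sequentially. (indicator ((\<Union>i<k. B i) \<inter> ?I) r :: real) = indicator (\<Union> (range B) \<inter> ?I) r"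
          by (intro eventually_sequentiallyI[of "Suc i"]) (auto simp: indicator_def)
        then show "(\<lambda>k. indicator ((\<Union>i<k. B i) \<inter> ?I) r) \<longlonglongrightarrow> (indicator (\<Union> (range B) \<inter> ?I) r :: real)"
          by (rule tendsto_eventually)
      qed (auto simp: indicator_def)
      have "cos_transform (\<lambda>r. \<Sum>i<k. indicator (B i \<inter> ?I) r) = (\<lambda>s. \<Sum>i<k. cos_transform (indicator (B i \<inter> ?I)) s)" for k
        unfolding fun_eq_iff cos_transform_def sum_distrib_right
        using int[OF B] by (intro allI Bochner_Integration.integral_sum integrable_mult_cos)
      then show "(cos_transform (\<lambda>r. \<Sum>i<k. indicator (B i \<inter> ?I) r) \<longlongrightarrow> 0) at_infinity" for k
        by (simp only:) (intro tendsto_null_sum union)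
    qed (use int B in auto)
  qed
qed

text \<open>Induction over integrable functions: sets of finite measure are exhausted by their
  bounded parts, sums are immediate by linearity, and limits are covered by domination.\<close>

theorem cos_transform_tendsto_0:
  assumes "integrable lborel f"
  shows "(cos_transform f \<longlongrightarrow> 0) at_infinity"
  using assms
proof (induction rule: integrable_induct)
  case (base A c)
  have [measurable]: "A \<in> sets borel" using base by simp
  have int: "integrable lborel (indicator A :: real \<Rightarrow> real)"
    using base by (simp add: integrable_indicator_iff)
  have "(cos_transform (indicator A) \<longlongrightarrow> 0) at_infinity"
  proof (rule cos_transform_tendsto_0_dominated[where g = "\<lambda>k. indicator (A \<inter> {-real k..real k})"])
    show "(cos_transform (indicator (A \<inter> {-real k..real k})) \<longlongrightarrow> 0) at_infinity" for k
      by (rule cos_transform_bounded_set_tendsto_0) measurable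
    show "integrable lborel (indicator (A \<inter> {-real k..real k}) :: real \<Rightarrow> real)" for k
      by (rule Bochner_Integration.integrable_bound[OF int]) (auto simp: indicator_def)
    show "(\<lambda>k. indicator (A \<inter> {-real k..real k}) r) \<longlonglongrightarrow> (indicator A r :: real)" for r
    proof (rule tendsto_eventually)
      show "\<forall>\<^sub>F k in sequentially. indicator (A \<inter> {-real k..real k}) r = (indicator A r :: real)"
        by (intro eventually_sequentiallyI[of "nat \<lceil>\<bar>r\<bar>\<rceil>"]) (auto simp: indicator_def nat_le_iff ceiling_le_iff abs_le_iff)
    qed
  qed (auto simp: indicator_def int)
  from tendsto_mult_left[OF this, of c] show ?case
    by (simp add: cos_transform_def[abs_def] ac_simps)
next
  case (add f g)
  have "cos_transform (\<lambda>r. f r + g r) s = cos_transform f s + cos_transform g s" for s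
    unfolding cos_transform_def distrib_right
    using add by (intro Bochner_Integration.integral_add integrable_mult_cos)
  then show ?case using tendsto_add[OF add(3,4)] by (simp add: fun_eq_iff[symmetric])
next
  case (lim f s)
  show ?case
    by (rule cos_transform_tendsto_0_dominated[where g = s]) (use lim in auto)
qed

subsection \<open>Fourier inversion\<close>

text \<open>With \<open>pi\<close> in the exponent the function is its own Fourier transform and has
  integral 1, so no normalizing constants appear later.\<close>

definition gauss :: "'a::euclidean_space \<Rightarrow> real" where
  "gauss v = exp (- pi * (norm v)\<^sup>2)"

lemma gauss_nonneg [simp]: "gauss v \<ge> 0"
  and gauss_le_1: "gauss v \<le> 1"
  and gauss_0 [simp]: "gauss 0 = 1"
  by (simp_all add: gauss_def)

lemma borel_measurable_gauss [measurable]: "gauss \<in> borel_measurable borel"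
  unfolding gauss_def by measurable

lemma gauss_prod: "gauss v = (\<Prod>b\<in>Basis. gauss (v \<bullet> b))"
proof -
  have "(norm v)\<^sup>2 = (\<Sum>b\<in>Basis. (v \<bullet> b)\<^sup>2)"
    unfolding power2_norm_eq_inner by (subst euclidean_inner) (simp add: power2_eq_square)
  then show ?thesis
    by (simp add: gauss_def exp_sum[symmetric] sum_negf sum_distrib_left[symmetric])
qed

text \<open>This is the characteristic function of the standard normal distribution after the
  substitution \<open>x = sqrt (2 * pi) * v\<close>, which turns \<open>x\<^sup>2 / 2\<close> into
  \<open>pi * v\<^sup>2\<close>; the Jacobian cancels the normalizing factor of the density.\<close>

lemma gauss_real:
  "integrable lborel (gauss :: real \<Rightarrow> real)"
  "(LINT v|lborel. cis (2 * pi * (z * v)) * complex_of_real (gauss v)) = complex_of_real (gauss (z :: real))"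
proof -
  let ?c = "sqrt (2 * pi)"
  have c: "?c > 0" "?c\<^sup>2 = 2 * pi" "?c \<noteq> 0" by auto
  have g: "std_normal_density (?c * v) = gauss v / ?c" for v
    by (simp add: std_normal_density_def gauss_def power_mult_distrib)
  have "integrable lborel (\<lambda>v. std_normal_density (0 + ?c * v))"
    using integrable_std_normal_moment[of 0]
    by (intro lborel_integrable_real_affine) auto
  then have "integrable lborel (\<lambda>v. ?c * std_normal_density (?c * v))" by simp
  then show "integrable lborel (gauss :: real \<Rightarrow> real)"
    by (simp add: g)
  have "complex_of_real (gauss z) = char std_normal_distribution (?c * z)"
    by (simp add: char_std_normal_distribution gauss_def power_mult_distrib)
  also have "\<dots> = (CLINT x|lborel. std_normal_density x *\<^sub>R iexp (?c * z * x))"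
    unfolding char_def by (subst integral_density) (auto simp: normal_density_nonneg)
  also have "\<dots> = ?c *\<^sub>R (CLINT v|lborel. std_normal_density (0 + ?c * v) *\<^sub>R iexp (?c * z * (0 + ?c * v)))"
    using c by (subst lborel_integral_real_affine[of ?c _ 0]) auto
  also have "\<dots> = (CLINT v|lborel. ?c *\<^sub>R (std_normal_density (0 + ?c * v) *\<^sub>R iexp (?c * z * (0 + ?c * v))))"
    by (rule integral_scaleR_right[symmetric])
  also have "\<dots> = (CLINT v|lborel. cis (2 * pi * (z * v)) * complex_of_real (gauss v))"
  proof (rule Bochner_Integration.integral_cong[OF refl])
    fix v :: real
    have "?c * z * (0 + ?c * v) = ?c\<^sup>2 * (z * v)"
      by (simp only: power2_eq_square mult_ac add_0)
    then have "iexp (?c * z * (0 + ?c * v)) = cis (2 * pi * (z * v))"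
      by (simp only: c(2) cis_conv_exp)
    moreover have "?c *\<^sub>R (std_normal_density (0 + ?c * v) *\<^sub>R w) = w * complex_of_real (gauss v)" for w :: complex
    proof -
      have "?c *\<^sub>R (std_normal_density (0 + ?c * v) *\<^sub>R w) = (?c * std_normal_density (?c * v)) *\<^sub>R w" by simp
      also have "?c * std_normal_density (?c * v) = gauss v" unfolding g using c(3) by simp
      finally show ?thesis by (simp only: scaleR_conv_of_real mult.commute)
    qed
    ultimately show "?c *\<^sub>R (std_normal_density (0 + ?c * v) *\<^sub>R iexp (?c * z * (0 + ?c * v))) = cis (2 * pi * (z * v)) * complex_of_real (gauss v)"
      by (simp only:)
  qed
  finally show "(LINT v|lborel. cis (2 * pi * (z * v)) * complex_of_real (gauss v)) = complex_of_real (gauss z)"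
    by simp
qed

lemma cis_sum: "finite I \<Longrightarrow> cis (\<Sum>i\<in>I. f i) = (\<Prod>i\<in>I. cis (f i))"
  by (induction rule: finite_induct) (auto simp: cis_mult[symmetric])

lemma borel_measurable_cis [measurable]: "cis \<in> borel_measurable borel"
  by (intro borel_measurable_continuous_onI continuous_intros)

context
begin

interpretation product_sigma_finite "\<lambda>_ :: 'a::euclidean_space. lborel :: real measure"
  by standard

text \<open>Via \<open>lborel_eq\<close>, Lebesgue measure is an image of the product of
  one-dimensional ones. This carries the Gaussian from dimension one to every dimension.\<close>

lemma integral_lborel_prod:
  fixes f :: "'a::euclidean_space \<Rightarrow> real \<Rightarrow> 'b::{real_normed_field, banach, second_countable_topology}"
  assumes f: "\<And>b. b \<in> Basis \<Longrightarrow> integrable lborel (f b)"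
  shows "integrable lborel (\<lambda>x. \<Prod>b\<in>Basis. f b (x \<bullet> b))"
    and "(LINT x|lborel. (\<Prod>b\<in>Basis. f b (x \<bullet> b))) = (\<Prod>b\<in>Basis. integral\<^sup>L lborel (f b))"
proof -
  have [measurable]: "f b \<in> borel_measurable borel" if "b \<in> Basis" for b
    using f[OF that] by auto
  have m[measurable]: "(\<lambda>x. \<Prod>b\<in>Basis. f b (x \<bullet> b)) \<in> borel_measurable borel"
    by (intro borel_measurable_prod) measurable
  have T[measurable]: "(\<lambda>y. \<Sum>b\<in>Basis. y b *\<^sub>R b) \<in> (\<Pi>\<^sub>M b\<in>Basis. lborel) \<rightarrow>\<^sub>M (borel :: 'a measure)"
    by measurable
  have inner: "(\<Prod>b\<in>Basis. f b ((\<Sum>b\<in>Basis. y b *\<^sub>R b) \<bullet> b)) = (\<Prod>b\<in>Basis. f b (y b))" for y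
    by (intro prod.cong) (auto simp: inner_sum_left inner_Basis if_distrib cong: if_cong)
  show "integrable lborel (\<lambda>x. \<Prod>b\<in>Basis. f b (x \<bullet> b))"
    by (subst lborel_eq, subst integrable_distr_eq) (auto simp: inner intro!: product_integrable_prod f)
  show "(LINT x|lborel. (\<Prod>b\<in>Basis. f b (x \<bullet> b))) = (\<Prod>b\<in>Basis. integral\<^sup>L lborel (f b))"
    by (subst lborel_eq, subst integral_distr) (auto simp: inner intro!: product_integral_prod f)
qed

end

lemma integrable_gauss: "integrable lborel (gauss :: 'a::euclidean_space \<Rightarrow> real)"
proof -
  have "integrable lborel (\<lambda>x :: 'a. \<Prod>b\<in>Basis. gauss (x \<bullet> b))"
    by (rule integral_lborel_prod(1)[OF gauss_real(1)])
  then show ?thesis by (simp flip: gauss_prod)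
qed

lemma fourier_gauss:
  fixes z :: "'a::euclidean_space"
  shows "(LINT v|lborel. cis (2 * pi * (z \<bullet> v)) * complex_of_real (gauss v)) = complex_of_real (gauss z)"
proof -
  have "(LINT v|lborel. cis (2 * pi * (z \<bullet> v)) * complex_of_real (gauss v)) =
    (LINT v|lborel. (\<Prod>b\<in>Basis. cis (2 * pi * ((z \<bullet> b) * (v \<bullet> b))) * complex_of_real (gauss (v \<bullet> b))))"
  proof (rule Bochner_Integration.integral_cong[OF refl])
    fix v :: 'a
    have "cis (2 * pi * (z \<bullet> v)) = cis (\<Sum>b\<in>Basis. 2 * pi * ((z \<bullet> b) * (v \<bullet> b)))"
      by (subst euclidean_inner) (simp only: sum_distrib_left)
    also have "\<dots> = (\<Prod>b\<in>Basis. cis (2 * pi * ((z \<bullet> b) * (v \<bullet> b))))"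
      by (rule cis_sum) simp
    finally show "cis (2 * pi * (z \<bullet> v)) * complex_of_real (gauss v) =
        (\<Prod>b\<in>Basis. cis (2 * pi * ((z \<bullet> b) * (v \<bullet> b))) * complex_of_real (gauss (v \<bullet> b)))"
      by (simp only: prod.distrib of_real_prod gauss_prod[of v])
  qed
  also have "\<dots> = (\<Prod>b\<in>Basis. complex_of_real (gauss (z \<bullet> b)))"
  proof (subst integral_lborel_prod)
    fix b :: 'a
    show "integrable lborel (\<lambda>x. cis (2 * pi * ((z \<bullet> b) * x)) * complex_of_real (gauss x))"
      by (rule Bochner_Integration.integrable_bound[OF gauss_real(1)]) (auto simp: norm_mult)
  qed (simp add: gauss_real(2))
  also have "\<dots> = complex_of_real (gauss z)"
    by (subst (2) gauss_prod) simp
  finally show ?thesis .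
qed

lemma integral_gauss: "(LINT v|lborel. gauss (v :: 'a::euclidean_space)) = 1"
proof -
  have "complex_of_real (LINT v|lborel. gauss (v :: 'a)) = 1"
    using fourier_gauss[of "0 :: 'a"] by simp
  then show ?thesis by simp
qed

section \<open>Substitution, product integrands, and functions with vanishing integrals\<close>

lemma lborel_integral_affine:
  fixes f :: "'a::euclidean_space \<Rightarrow> 'b::{banach, second_countable_topology}"
  assumes c: "c \<noteq> 0" and f: "f \<in> borel_measurable borel"
  shows "(LINT x|lborel. f x) = \<bar>c\<bar> ^ DIM('a) *\<^sub>R (LINT x|lborel. f (t + c *\<^sub>R x))"
    and "integrable lborel f \<longleftrightarrow> integrable lborel (\<lambda>x. f (t + c *\<^sub>R x))"
proof -
  have [measurable]: "f \<in> borel_measurable borel" by fact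
  note * = arg_cong[OF lborel_affine[OF c, of t]]
  show "(LINT x|lborel. f x) = \<bar>c\<bar> ^ DIM('a) *\<^sub>R (LINT x|lborel. f (t + c *\<^sub>R x))"
    by (rule trans[OF *[of "\<lambda>M. integral\<^sup>L M f"]]) (simp add: integral_density integral_distr)
  show "integrable lborel f \<longleftrightarrow> integrable lborel (\<lambda>x. f (t + c *\<^sub>R x))"
  proof -
    let ?g = "\<lambda>x. f (t + c *\<^sub>R x)" and ?k = "\<bar>c\<bar> ^ DIM('a)"
    have "integrable lborel f \<longleftrightarrow> integrable lborel (\<lambda>x. ?k *\<^sub>R ?g x)"
      by (rule trans[OF *[of "\<lambda>M. integrable M f"]]) (simp add: integrable_density integrable_distr_eq)
    also have "\<dots> \<longleftrightarrow> integrable lborel ?g"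
      using integrable_scaleR_right[of "1 / ?k" lborel "\<lambda>x. ?k *\<^sub>R ?g x"] c by auto
    finally show ?thesis .
  qed
qed

lemma integrable_pair_mult:
  fixes f :: "'a \<Rightarrow> 'c::{real_normed_field, banach, second_countable_topology}" and g :: "'b \<Rightarrow> 'c"
  assumes "pair_sigma_finite M N" and f: "integrable M f" and g: "integrable N g"
  shows "integrable (M \<Otimes>\<^sub>M N) (\<lambda>p. f (fst p) * g (snd p))"
proof -
  interpret pair_sigma_finite M N by fact
  have [measurable]: "f \<in> borel_measurable M" "g \<in> borel_measurable N" using f g by auto
  show ?thesis
    by (rule Fubini_integrable) (auto simp: norm_mult intro!: f g)
qed

text \<open>\<open>h\<close> is only locally integrable, as a bounded function in the inversion
  theorem will be, so the argument is run inside each ball. There the sets with vanishing integral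
  form a Dynkin system containing the closed sets, because a closed set meets the ball in a compact
  one.\<close>

lemma AE_zero_if_integral_zero_on_compacts:
  fixes h :: "'a::euclidean_space \<Rightarrow> 'b::{banach, second_countable_topology}"
  assumes h: "\<And>R. integrable lborel (\<lambda>x. indicator (cball 0 R) x *\<^sub>R h x)"
    and zero: "\<And>K. compact K \<Longrightarrow> (LINT x|lborel. indicator K x *\<^sub>R h x) = 0"
  shows "AE x in lborel. h x = 0"
proof -
  have ball: "AE x in lborel. indicator (cball 0 R) x *\<^sub>R h x = 0" for R :: real
  proof (rule sigma_finite_measure.density_zero[OF lborel.sigma_finite_measure_axioms h])
    fix A :: "'a set" assume "A \<in> sets lborel"
    then have A: "A \<in> sigma_sets UNIV (Collect closed)"
      by (simp add: borel_eq_closed)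
    have "Int_stable (Collect closed :: 'a set set)"
      by (rule Int_stableI) auto
    moreover have "Collect closed \<subseteq> Pow (UNIV :: 'a set)" by simp
    moreover note A
    ultimately show "(LINT x:A|lborel. indicator (cball 0 R) x *\<^sub>R h x) = 0"
      unfolding set_lebesgue_integral_def
    proof (induction rule: sigma_sets_induct_disjoint)
      case (basic B)
      then have "compact (B \<inter> cball 0 R)" by (auto intro: closed_Int_compact)
      from zero[OF this] show ?case by (simp add: indicator_inter_arith)
    next
      case empty
      show ?case by simp
    next
      case (compl B)
      then have [measurable]: "B \<in> sets borel" by (simp add: borel_eq_closed)
      have "(LINT x|lborel. indicator (UNIV - B) x *\<^sub>R indicator (cball 0 R) x *\<^sub>R h x) =
          (LINT x|lborel. indicator (cball 0 R) x *\<^sub>R h x - indicator B x *\<^sub>R indicator (cball 0 R) x *\<^sub>R h x)"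
        by (intro Bochner_Integration.integral_cong) (auto simp: indicator_def)
      also have "\<dots> = 0"
      proof (subst Bochner_Integration.integral_diff[OF h])
        show "integrable lborel (\<lambda>x. indicator B x *\<^sub>R indicator (cball 0 R) x *\<^sub>R h x)"
          by (intro integrable_mult_indicator h) measurable
      qed (use compl zero[of "cball 0 R"] in simp)
      finally show ?case .
    next
      case (union B)
      have [measurable]: "B i \<in> sets borel" for i using union by (auto simp: borel_eq_closed)
      have "(LINT x:(\<Union> (range B))|lborel. indicator (cball 0 R) x *\<^sub>R h x) =
         (\<Sum>i. (LINT x:B i|lborel. indicator (cball 0 R) x *\<^sub>R h x))"
      proof (rule lebesgue_integral_countable_add)
        show "set_integrable lborel (\<Union> (range B)) (\<lambda>x. indicator (cball 0 R) x *\<^sub>R h x)"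
          unfolding set_integrable_def by (intro integrable_mult_indicator h) measurable
      qed (use union in \<open>auto simp: disjoint_family_on_def\<close>)
      then show ?case using union by (simp add: set_lebesgue_integral_def)
    qed
  qed
  have "AE x in lborel. \<forall>n::nat. indicator (cball 0 (real n)) x *\<^sub>R h x = 0"
    unfolding AE_all_countable using ball by blast
  then show ?thesis
  proof eventually_elim
    case (elim x)
    obtain n :: nat where "norm x \<le> real n" using real_arch_simple by blast
    then show ?case using elim[rule_format, of n] by simp
  qed
qed

lemma AE_zero_if_integral_zero_test_functions:
  fixes h :: "'a::euclidean_space \<Rightarrow> 'b::{banach, second_countable_topology}"
  assumes h: "\<And>R. integrable lborel (\<lambda>x. indicator (cball 0 R) x *\<^sub>R h x)"
    and meas [measurable]: "h \<in> borel_measurable borel"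
    and zero: "\<And>\<phi> :: 'a \<Rightarrow> real. continuous_on UNIV \<phi> \<Longrightarrow> (\<And>x. 0 \<le> \<phi> x) \<Longrightarrow> (\<And>x. \<phi> x \<le> 1) \<Longrightarrow>
      integrable lborel \<phi> \<Longrightarrow> (LINT x|lborel. \<phi> x *\<^sub>R h x) = 0"
  shows "AE x in lborel. h x = 0"
proof (rule AE_zero_if_integral_zero_on_compacts[OF h])
  fix K :: "'a set" assume K: "compact K"
  show "(LINT x|lborel. indicator K x *\<^sub>R h x) = 0"
  proof (cases "K = {}")
    case False
    have [measurable]: "K \<in> sets borel" using K by (simp add: compact_imp_closed)
    obtain R where R: "K \<subseteq> cball 0 R"
      using compact_imp_bounded[OF K] by (auto simp: bounded_iff subset_iff)
    \<comment> \<open>A continuous tent: 1 on \<open>K\<close>, and 0 from distance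
      \<open>1 / Suc n\<close> on. Using \<open>Suc n\<close> keeps every support within distance 1
      of \<open>K\<close>, hence in the single ball of radius \<open>R + 1\<close> that provides the
      dominating function.\<close>
    define \<phi> where "\<phi> n x = max 0 (1 - real (Suc n) * infdist x K)" for n x
    have cont: "continuous_on UNIV (\<phi> n)" for n
      unfolding \<phi>_def by (intro continuous_intros)
    have [measurable]: "\<phi> n \<in> borel_measurable borel" for n
      by (intro borel_measurable_continuous_onI cont)
    have range: "0 \<le> \<phi> n x" "\<phi> n x \<le> 1" for n x
      by (auto simp: \<phi>_def infdist_nonneg)
    have supp: "\<phi> n x \<le> indicator (cball 0 (R + 1)) x" for n x
    proof (cases "x \<in> cball 0 (R + 1)")
      case True then show ?thesis by (simp add: range)
    next
      case out: False
      obtain y where y: "y \<in> K" "infdist x K = dist x y"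
        using infdist_attains_inf[OF compact_imp_closed[OF K] False] by metis
      then have "norm y \<le> R" using R by auto
      moreover have "norm x \<le> norm y + dist x y"
        by (metis dist_norm norm_triangle_sub)
      ultimately have d: "infdist x K > 1" using out y by auto
      have "1 * 1 \<le> real (Suc n) * infdist x K" using d by (intro mult_mono) auto
      then show ?thesis using out by (simp add: \<phi>_def)
    qed
    have int: "integrable lborel (\<phi> n)" for n
    proof (rule Bochner_Integration.integrable_bound)
      show "integrable lborel (indicator (cball 0 (R + 1)) :: 'a \<Rightarrow> real)"
        using emeasure_lborel_cball_finite by (simp add: integrable_indicator_iff)
      show "AE x in lborel. norm (\<phi> n x) \<le> norm (indicator (cball 0 (R + 1)) x :: real)"
        using supp range by (intro AE_I2) (simp add: abs_of_nonneg)
    qed measurable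
    have "(\<lambda>n. LINT x|lborel. \<phi> n x *\<^sub>R h x) \<longlonglongrightarrow> (LINT x|lborel. indicator K x *\<^sub>R h x)"
    proof (rule integral_dominated_convergence[where w = "\<lambda>x. norm (indicator (cball 0 (R + 1)) x *\<^sub>R h x)"])
      show "AE x in lborel. norm (\<phi> n x *\<^sub>R h x) \<le> norm (indicator (cball 0 (R + 1)) x *\<^sub>R h x)" for n
        using supp range by (intro AE_I2) (simp add: mult_right_mono)
      show "AE x in lborel. (\<lambda>n. \<phi> n x *\<^sub>R h x) \<longlonglongrightarrow> indicator K x *\<^sub>R h x"
      proof (intro AE_I2 tendsto_scaleR tendsto_const)
        fix x
        show "(\<lambda>n. \<phi> n x) \<longlonglongrightarrow> indicator K x"
        proof (cases "x \<in> K")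
          case True then show ?thesis by (simp add: \<phi>_def)
        next
          case out: False
          then have d: "infdist x K > 0"
            using infdist_pos_not_in_closed[OF compact_imp_closed[OF K] False] by simp
          have "\<forall>\<^sub>F n in sequentially. \<phi> n x = indicator K x"
          proof (rule eventually_sequentiallyI[of "nat \<lceil>1 / infdist x K\<rceil>"])
            fix n assume "nat \<lceil>1 / infdist x K\<rceil> \<le> n"
            then have "1 / infdist x K \<le> real (Suc n)" by linarith
            then have "1 \<le> real (Suc n) * infdist x K" using d by (simp add: field_simps)
            then show "\<phi> n x = indicator K x" using out by (simp add: \<phi>_def)
          qed
          then show ?thesis by (rule tendsto_eventually)
        qed
      qed
      show "integrable lborel (\<lambda>x. norm (indicator (cball 0 (R + 1)) x *\<^sub>R h x))"
        by (intro integrable_norm h)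
    qed measurable
    moreover have "(LINT x|lborel. \<phi> n x *\<^sub>R h x) = 0" for n
      by (intro zero cont range int)
    ultimately show ?thesis by (simp add: LIMSEQ_const_iff)
  qed simp
qed

section \<open>Gaussian regularization and the inversion theorem\<close>

lemma integrable_cis_mult:
  fixes f :: "'a \<Rightarrow> complex"
  assumes "integrable M f" and [measurable]: "\<theta> \<in> borel_measurable M"
  shows "integrable M (\<lambda>x. cis (\<theta> x) * f x)"
proof -
  have [measurable]: "f \<in> borel_measurable M" using assms by auto
  show ?thesis by (rule Bochner_Integration.integrable_bound[OF assms(1)]) (auto simp: norm_mult)
qed

lemma continuous_cis_integral:
  fixes f :: "'a::euclidean_space \<Rightarrow> complex"
  assumes f: "integrable lborel f"
  shows "continuous_on UNIV (\<lambda>v. LINT x|lborel. cis (c * (x \<bullet> v)) * f x)"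
proof (rule continuous_integral[where w = "\<lambda>x. norm (f x)"])
  show "(\<lambda>x. cis (c * (x \<bullet> v)) * f x) \<in> borel_measurable lborel" for v
    using integrable_cis_mult[OF f, of "\<lambda>x. c * (x \<bullet> v)"] by auto
qed (use f in \<open>auto simp: norm_mult intro!: continuous_intros\<close>)

lemma fourier_gauss_scaled:
  fixes z :: "'a::euclidean_space"
  assumes t: "t > 0"
  shows "(LINT v|lborel. cis (2 * pi * (z \<bullet> v)) * complex_of_real (gauss (t *\<^sub>R v))) =
    complex_of_real (gauss (z /\<^sub>R t) / t ^ DIM('a))"
    and "integrable lborel (\<lambda>v :: 'a. gauss (t *\<^sub>R v))"
proof -
  have [simp]: "t \<noteq> 0" using t by simp
  have "(LINT v|lborel. cis (2 * pi * (z \<bullet> v)) * complex_of_real (gauss (t *\<^sub>R v))) =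
    \<bar>1 / t\<bar> ^ DIM('a) *\<^sub>R (LINT v|lborel. cis (2 * pi * ((z /\<^sub>R t) \<bullet> v)) * complex_of_real (gauss v))"
    using t by (subst lborel_integral_affine(1)[of "1 / t" _ 0]) (auto simp: divide_inverse)
  also have "\<dots> = complex_of_real (gauss (z /\<^sub>R t) / t ^ DIM('a))"
    using t by (simp only: fourier_gauss) (simp add: scaleR_conv_of_real field_simps)
  finally show "(LINT v|lborel. cis (2 * pi * (z \<bullet> v)) * complex_of_real (gauss (t *\<^sub>R v))) =
    complex_of_real (gauss (z /\<^sub>R t) / t ^ DIM('a))" .
  show "integrable lborel (\<lambda>v :: 'a. gauss (t *\<^sub>R v))"
    using lborel_integral_affine(2)[of t "gauss :: 'a \<Rightarrow> real" 0] integrable_gauss[where 'a = 'a] by simp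
qed

text \<open>The substitution \<open>x = y + t *\<^sub>R u\<close> moves all dependence on
  \<open>t\<close> into the argument of \<open>\<phi>\<close>, so that the weight
  \<open>gauss\<close> stays fixed as \<open>t\<close> tends to 0.\<close>

lemma integral_gauss_convolution:
  fixes \<phi> :: "'a::euclidean_space \<Rightarrow> 'b::{banach, second_countable_topology}"
  assumes t: "t > 0" and [measurable]: "\<phi> \<in> borel_measurable borel"
  shows "(LINT x|lborel. (gauss ((x - y) /\<^sub>R t) / t ^ DIM('a)) *\<^sub>R \<phi> x) =
    (LINT u|lborel. gauss u *\<^sub>R \<phi> (y + t *\<^sub>R u))"
proof -
  have "(LINT x|lborel. (gauss ((x - y) /\<^sub>R t) / t ^ DIM('a)) *\<^sub>R \<phi> x) =
    t ^ DIM('a) *\<^sub>R (LINT u|lborel. (gauss u / t ^ DIM('a)) *\<^sub>R \<phi> (y + t *\<^sub>R u))"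
    using t by (subst lborel_integral_affine(1)[of t _ y]) auto
  also have "\<dots> = (LINT u|lborel. t ^ DIM('a) *\<^sub>R ((gauss u / t ^ DIM('a)) *\<^sub>R \<phi> (y + t *\<^sub>R u)))"
    by (rule integral_scaleR_right[symmetric])
  also have "\<dots> = (LINT u|lborel. gauss u *\<^sub>R \<phi> (y + t *\<^sub>R u))"
    using t by simp
  finally show ?thesis .
qed

text \<open>The Gaussian makes the double integrand absolutely integrable in \<open>v\<close> and
  \<open>y\<close> jointly, so Fubini applies; the integral over \<open>v\<close> is then the
  transform of a scaled Gaussian.\<close>

lemma fourier_gauss_regularized:
  fixes f :: "'a::euclidean_space \<Rightarrow> complex"
  assumes f: "integrable lborel f" and t: "t > 0"
  defines "fh \<equiv> \<lambda>v. LINT y|lborel. cis (- 2 * pi * (y \<bullet> v)) * f y"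
  shows "(LINT v|lborel. cis (2 * pi * (x \<bullet> v)) * fh v * complex_of_real (gauss (t *\<^sub>R v))) =
    (LINT y|lborel. complex_of_real (gauss ((x - y) /\<^sub>R t) / t ^ DIM('a)) * f y)"
proof -
  have [measurable]: "f \<in> borel_measurable borel" using f by auto
  let ?k = "\<lambda>v y. cis (2 * pi * ((x - y) \<bullet> v)) * (complex_of_real (gauss (t *\<^sub>R v)) * f y)"
  have "integrable (lborel \<Otimes>\<^sub>M lborel) (\<lambda>p :: 'a \<times> 'a. complex_of_real (gauss (t *\<^sub>R fst p)) * f (snd p))"
    by (intro integrable_pair_mult lborel_pair.pair_sigma_finite_axioms f integrable_of_real fourier_gauss_scaled t)
  then have "integrable (lborel \<Otimes>\<^sub>M lborel) (\<lambda>p. ?k (fst p) (snd p))"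
    by (rule integrable_cis_mult) measurable
  then have int: "integrable (lborel \<Otimes>\<^sub>M lborel) (case_prod ?k)" by (simp add: split_beta')
  have "(LINT v|lborel. cis (2 * pi * (x \<bullet> v)) * fh v * complex_of_real (gauss (t *\<^sub>R v))) =
      (LINT v|lborel. LINT y|lborel. ?k v y)"
  proof (rule Bochner_Integration.integral_cong[OF refl])
    fix v
    have "?k v y = (cis (2 * pi * (x \<bullet> v)) * complex_of_real (gauss (t *\<^sub>R v))) * (cis (- 2 * pi * (y \<bullet> v)) * f y)" for y
      by (simp add: inner_diff_left right_diff_distrib cis_divide[symmetric] divide_inverse cis_inverse mult_ac)
    then have "(LINT y|lborel. ?k v y) = (cis (2 * pi * (x \<bullet> v)) * complex_of_real (gauss (t *\<^sub>R v))) * fh v"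
      unfolding fh_def by (simp only: integral_mult_right_zero)
    then show "cis (2 * pi * (x \<bullet> v)) * fh v * complex_of_real (gauss (t *\<^sub>R v)) = (LINT y|lborel. ?k v y)"
      by (simp only: mult_ac)
  qed
  also have "\<dots> = (LINT y|lborel. LINT v|lborel. ?k v y)"
    by (rule lborel_pair.Fubini_integral[OF int, symmetric])
  also have "\<dots> = (LINT y|lborel. complex_of_real (gauss ((x - y) /\<^sub>R t) / t ^ DIM('a)) * f y)"
  proof (rule Bochner_Integration.integral_cong[OF refl])
    fix y
    have "(LINT v|lborel. ?k v y) =
      (LINT v|lborel. cis (2 * pi * ((x - y) \<bullet> v)) * complex_of_real (gauss (t *\<^sub>R v)) * f y)"
      by (simp only: mult.assoc)
    also have "\<dots> = (LINT v|lborel. cis (2 * pi * ((x - y) \<bullet> v)) * complex_of_real (gauss (t *\<^sub>R v))) * f y"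
      by (rule integral_mult_left_zero)
    finally show "(LINT v|lborel. ?k v y) = complex_of_real (gauss ((x - y) /\<^sub>R t) / t ^ DIM('a)) * f y"
      by (simp only: fourier_gauss_scaled(1)[OF t])
  qed
  finally show ?thesis .
qed

text \<open>
  Inserting the factor \<open>gauss (t v)\<close> into the inversion integral turns it into a convolution of \<open>f\<close>
  with a Gaussian of width \<open>t\<close>. Tested against continuous functions, this converges to \<open>f\<close> as
  \<open>t \<rightarrow> 0\<close>, which avoids the continuity of translations in \<open>L\<^sup>1\<close>.
\<close>

theorem fourier_inversion:
  fixes f :: "'a::euclidean_space \<Rightarrow> complex"
  assumes f: "integrable lborel f"
  defines "fh \<equiv> \<lambda>v. LINT y|lborel. cis (- 2 * pi * (y \<bullet> v)) * f y"
  assumes fh: "integrable lborel fh"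
  shows "AE x in lborel. (LINT v|lborel. cis (2 * pi * (x \<bullet> v)) * fh v) = f x"
proof -
  have [measurable]: "f \<in> borel_measurable borel" "fh \<in> borel_measurable borel"
    using f fh by auto
  define g where "g x = (LINT v|lborel. cis (2 * pi * (x \<bullet> v)) * fh v)" for x
  have "g = (\<lambda>x. LINT v|lborel. cis (2 * pi * (v \<bullet> x)) * fh v)"
    by (simp add: g_def[abs_def] inner_commute)
  then have "continuous_on UNIV g"
    using continuous_cis_integral[OF fh] by simp
  then have [measurable]: "g \<in> borel_measurable borel"
    by (rule borel_measurable_continuous_onI)
  \<comment> \<open>This constant bounds \<open>g\<close> and all its regularizations
    \<open>g' n\<close> uniformly, so \<open>B * \<phi>\<close> dominates every integral tested
    against \<open>\<phi>\<close>.\<close>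
  define B where "B = (LINT v|lborel. norm (fh v))"
  have gB: "norm (g x) \<le> B" for x
  proof -
    have "norm (g x) \<le> (LINT v|lborel. norm (cis (2 * pi * (x \<bullet> v)) * fh v))"
      unfolding g_def by (rule integral_norm_bound)
    then show ?thesis by (simp add: norm_mult B_def)
  qed
  have "AE x in lborel. g x - f x = 0"
  proof (rule AE_zero_if_integral_zero_test_functions)
    fix R :: real
    have [measurable]: "cball (0 :: 'a) R \<in> sets borel" by simp
    have "integrable lborel (\<lambda>x :: 'a. indicator (cball 0 R) x *\<^sub>R g x)"
    proof (rule Bochner_Integration.integrable_bound)
      show "integrable lborel (\<lambda>x :: 'a. B * indicator (cball 0 R) x :: real)"
        using emeasure_lborel_cball_finite by (intro integrable_mult_right) (simp add: integrable_indicator_iff)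
      show "AE x in lborel. norm (indicator (cball 0 R) x *\<^sub>R g x) \<le> norm (B * indicator (cball 0 R) x :: real)"
        using gB by (intro AE_I2) (auto simp: indicator_def intro: order_trans[OF gB abs_ge_self])
    qed measurable
    moreover have "integrable lborel (\<lambda>x :: 'a. indicator (cball 0 R) x *\<^sub>R f x)"
      by (intro integrable_mult_indicator f) measurable
    ultimately show "integrable lborel (\<lambda>x :: 'a. indicator (cball 0 R) x *\<^sub>R (g x - f x))"
      unfolding scaleR_diff_right by (rule Bochner_Integration.integrable_diff)
  next
    fix \<phi> :: "'a \<Rightarrow> real"
    assume \<phi>: "continuous_on UNIV \<phi>" "\<And>x. 0 \<le> \<phi> x" "\<And>x. \<phi> x \<le> 1" "integrable lborel \<phi>"
    have [measurable]: "\<phi> \<in> borel_measurable borel" using \<phi> by auto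
    define t where "t n = 1 / real (Suc n)" for n
    have t: "t n > 0" for n by (simp add: t_def)
    have t0: "t \<longlonglongrightarrow> 0" unfolding t_def by (rule LIMSEQ_Suc[OF lim_1_over_n])
    define g' where "g' n x = (LINT v|lborel. cis (2 * pi * (x \<bullet> v)) * fh v * complex_of_real (gauss (t n *\<^sub>R v)))" for n x
    have g'_eq: "g' n x = (LINT y|lborel. complex_of_real (gauss ((x - y) /\<^sub>R t n) / t n ^ DIM('a)) * f y)" for n x
      unfolding g'_def fh_def by (rule fourier_gauss_regularized[OF f t])
    have [measurable]: "g' n \<in> borel_measurable borel" for n
      unfolding g'_def by measurable
    have "norm (g' n x) \<le> B" for n x
    proof -
      have "norm (g' n x) \<le> (LINT v|lborel. norm (cis (2 * pi * (x \<bullet> v)) * fh v * complex_of_real (gauss (t n *\<^sub>R v))))"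
        unfolding g'_def by (rule integral_norm_bound)
      also have "\<dots> \<le> B" unfolding B_def
      proof (rule integral_mono')
        show "integrable lborel (\<lambda>v. norm (fh v))" using fh by simp
      qed (auto simp: norm_mult mult_left_le gauss_le_1)
      finally show ?thesis .
    qed
    \<comment> \<open>Two nested dominated limits: the inner one over \<open>v\<close> is dominated
      by \<open>norm (fh v)\<close>, the outer one over \<open>x\<close> by
      \<open>B * \<phi> x\<close>.\<close>
    have lim1: "(\<lambda>n. LINT x|lborel. \<phi> x *\<^sub>R g' n x) \<longlonglongrightarrow> (LINT x|lborel. \<phi> x *\<^sub>R g x)"
    proof (rule integral_dominated_convergence[where w = "\<lambda>x. B * \<phi> x"])
      show "AE x in lborel. norm (\<phi> x *\<^sub>R g' n x) \<le> B * \<phi> x" for n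
        using \<open>norm (g' n _) \<le> B\<close> \<phi>(2) by (intro AE_I2) (simp add: mult.commute[of B] mult_left_mono)
      show "AE x in lborel. (\<lambda>n. \<phi> x *\<^sub>R g' n x) \<longlonglongrightarrow> \<phi> x *\<^sub>R g x"
      proof (intro AE_I2 tendsto_scaleR tendsto_const)
        fix x
        show "(\<lambda>n. g' n x) \<longlonglongrightarrow> g x"
          unfolding g'_def g_def
        proof (rule integral_dominated_convergence[where w = "\<lambda>v. norm (fh v)"])
          show "AE v in lborel. (\<lambda>n. cis (2 * pi * (x \<bullet> v)) * fh v * complex_of_real (gauss (t n *\<^sub>R v)))
              \<longlonglongrightarrow> cis (2 * pi * (x \<bullet> v)) * fh v"
          proof (rule AE_I2)
            fix v
            have "(\<lambda>n. cis (2 * pi * (x \<bullet> v)) * fh v * complex_of_real (gauss (t n *\<^sub>R v)))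
              \<longlonglongrightarrow> cis (2 * pi * (x \<bullet> v)) * fh v * complex_of_real (exp (- pi * (norm (0 *\<^sub>R v))\<^sup>2))"
              unfolding gauss_def by (intro tendsto_intros t0)
            then show "(\<lambda>n. cis (2 * pi * (x \<bullet> v)) * fh v * complex_of_real (gauss (t n *\<^sub>R v)))
              \<longlonglongrightarrow> cis (2 * pi * (x \<bullet> v)) * fh v" by simp
          qed
          show "AE v in lborel. norm (cis (2 * pi * (x \<bullet> v)) * fh v * complex_of_real (gauss (t n *\<^sub>R v))) \<le> norm (fh v)" for n
            by (auto simp: norm_mult mult_left_le gauss_le_1)
        qed (use fh in auto)
      qed
    qed (use \<phi>(4) in auto)
    \<comment> \<open>Fubini shifts the convolution from \<open>f\<close> to the test function,
      where continuity gives a pointwise limit. It applies because, for fixed \<open>n\<close>, the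
      kernel is at most \<open>1 / t n ^ d\<close> and both \<open>\<phi>\<close> and
      \<open>f\<close> are integrable.\<close>
    have eq: "(LINT x|lborel. \<phi> x *\<^sub>R g' n x) =
        (LINT y|lborel. complex_of_real (LINT u|lborel. gauss u * \<phi> (y + t n *\<^sub>R u)) * f y)" for n
    proof -
      let ?k = "\<lambda>x y. complex_of_real (gauss ((x - y) /\<^sub>R t n) / t n ^ DIM('a)) * (complex_of_real (\<phi> x) * f y)"
      have "integrable (lborel \<Otimes>\<^sub>M lborel) (\<lambda>p :: 'a \<times> 'a. complex_of_real (\<phi> (fst p)) * f (snd p))"
        by (intro integrable_pair_mult lborel_pair.pair_sigma_finite_axioms f integrable_of_real \<phi>)
      then have "integrable (lborel \<Otimes>\<^sub>M lborel) (\<lambda>p :: 'a \<times> 'a. complex_of_real (1 / t n ^ DIM('a)) * (complex_of_real (\<phi> (fst p)) * f (snd p)))"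
        by (intro integrable_mult_right)
      then have "integrable (lborel \<Otimes>\<^sub>M lborel) (\<lambda>p. ?k (fst p) (snd p))"
      proof (rule Bochner_Integration.integrable_bound)
        have "norm (?k x y) \<le> norm (complex_of_real (1 / t n ^ DIM('a)) * (complex_of_real (\<phi> x) * f y))" for x y
        proof -
          have "norm (complex_of_real (gauss ((x - y) /\<^sub>R t n) / t n ^ DIM('a))) \<le> norm (complex_of_real (1 / t n ^ DIM('a)))"
            using t[of n] by (simp add: norm_divide gauss_le_1 divide_right_mono)
          then show ?thesis unfolding norm_mult by (intro mult_right_mono) auto
        qed
        then show "AE p in lborel \<Otimes>\<^sub>M lborel. norm (?k (fst p) (snd p)) \<le>
            norm (complex_of_real (1 / t n ^ DIM('a)) * (complex_of_real (\<phi> (fst p)) * f (snd p)))"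
          by (intro AE_I2)
      qed measurable
      then have int: "integrable (lborel \<Otimes>\<^sub>M lborel) (case_prod ?k)" by (simp add: split_beta')
      have "(LINT x|lborel. \<phi> x *\<^sub>R g' n x) = (LINT x|lborel. LINT y|lborel. ?k x y)"
      proof (rule Bochner_Integration.integral_cong[OF refl])
        fix x
        have "\<phi> x *\<^sub>R g' n x = (LINT y|lborel. \<phi> x *\<^sub>R (complex_of_real (gauss ((x - y) /\<^sub>R t n) / t n ^ DIM('a)) * f y))"
          unfolding g'_eq by (rule integral_scaleR_right[symmetric])
        then show "\<phi> x *\<^sub>R g' n x = (LINT y|lborel. ?k x y)"
          by (simp only: scaleR_conv_of_real mult_ac)
      qed
      also have "\<dots> = (LINT y|lborel. LINT x|lborel. ?k x y)"
        by (rule lborel_pair.Fubini_integral[OF int, symmetric])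
      also have "\<dots> = (LINT y|lborel. complex_of_real (LINT u|lborel. gauss u * \<phi> (y + t n *\<^sub>R u)) * f y)"
      proof (rule Bochner_Integration.integral_cong[OF refl])
        fix y
        have "(LINT x|lborel. ?k x y) =
          (LINT x|lborel. complex_of_real ((gauss ((x - y) /\<^sub>R t n) / t n ^ DIM('a)) *\<^sub>R \<phi> x) * f y)"
          by (simp only: real_scaleR_def of_real_mult mult.assoc)
        also have "\<dots> = complex_of_real (LINT x|lborel. (gauss ((x - y) /\<^sub>R t n) / t n ^ DIM('a)) *\<^sub>R \<phi> x) * f y"
          by (simp only: integral_mult_left_zero integral_complex_of_real)
        also have "\<dots> = complex_of_real (LINT u|lborel. gauss u *\<^sub>R \<phi> (y + t n *\<^sub>R u)) * f y"
          by (subst integral_gauss_convolution[OF t]) auto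
        finally show "(LINT x|lborel. ?k x y) = complex_of_real (LINT u|lborel. gauss u * \<phi> (y + t n *\<^sub>R u)) * f y"
          by simp
      qed
      finally show ?thesis .
    qed
    define c where "c n y = (LINT u|lborel. gauss u * \<phi> (y + t n *\<^sub>R u))" for n y
    have [measurable]: "c n \<in> borel_measurable borel" for n
      unfolding c_def by measurable
    have c1: "\<bar>c n y\<bar> \<le> 1" for n y
    proof -
      have "\<bar>c n y\<bar> \<le> (LINT u|lborel. \<bar>gauss u * \<phi> (y + t n *\<^sub>R u)\<bar>)"
        unfolding c_def by (rule integral_abs_bound)
      also have "\<dots> \<le> (LINT (u::'a)|lborel. gauss u)"
        using \<phi>(2,3) by (intro integral_mono') (auto simp: integrable_gauss abs_mult mult_left_le)
      finally show ?thesis by (simp add: integral_gauss)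
    qed
    have c_lim: "(\<lambda>n. c n y) \<longlonglongrightarrow> \<phi> y" for y
    proof -
      have "(\<lambda>n. c n y) \<longlonglongrightarrow> (LINT (u::'a)|lborel. gauss u * \<phi> y)"
        unfolding c_def
      proof (rule integral_dominated_convergence[where w = gauss])
        show "AE u in lborel. (\<lambda>n. gauss u * \<phi> (y + t n *\<^sub>R u)) \<longlonglongrightarrow> gauss u * \<phi> y"
        proof (intro AE_I2 tendsto_mult tendsto_const)
          fix u :: 'a
          have "(\<lambda>n. y + t n *\<^sub>R u) \<longlonglongrightarrow> y + 0 *\<^sub>R u"
            by (intro tendsto_intros t0)
          then show "(\<lambda>n. \<phi> (y + t n *\<^sub>R u)) \<longlonglongrightarrow> \<phi> y"
            by (intro continuous_on_tendsto_compose[OF \<phi>(1)]) auto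
        qed
        show "AE u in lborel. norm (gauss u * \<phi> (y + t n *\<^sub>R u)) \<le> gauss u" for n
          using \<phi>(2,3) by (intro AE_I2) (auto simp: abs_mult mult_left_le)
      qed (auto simp: integrable_gauss)
      then show ?thesis by (simp add: integral_gauss)
    qed
    have "(\<lambda>n. LINT y|lborel. complex_of_real (c n y) * f y) \<longlonglongrightarrow> (LINT y|lborel. complex_of_real (\<phi> y) * f y)"
    proof (rule integral_dominated_convergence[where w = "\<lambda>y. norm (f y)"])
      show "AE y in lborel. (\<lambda>n. complex_of_real (c n y) * f y) \<longlonglongrightarrow> complex_of_real (\<phi> y) * f y"
        by (intro AE_I2 tendsto_intros c_lim)
      show "AE y in lborel. norm (complex_of_real (c n y) * f y) \<le> norm (f y)" for n
        using c1 by (intro AE_I2) (auto simp: norm_mult mult_left_le_one_le)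
    qed (use f in auto)
    \<comment> \<open>The same sequence has been shown to converge to the integral of
      \<open>\<phi>\<close> against \<open>g\<close> and against \<open>f\<close>.\<close>
    with lim1[unfolded eq, folded c_def]
    have "(LINT x|lborel. \<phi> x *\<^sub>R g x) = (LINT x|lborel. complex_of_real (\<phi> x) * f x)"
      by (rule LIMSEQ_unique)
    then have "(LINT x|lborel. \<phi> x *\<^sub>R g x) = (LINT x|lborel. \<phi> x *\<^sub>R f x)"
      by (simp only: scaleR_conv_of_real)
    moreover have "integrable lborel (\<lambda>x. \<phi> x *\<^sub>R g x)"
    proof (rule Bochner_Integration.integrable_bound)
      show "integrable lborel (\<lambda>x. B * \<phi> x)" using \<phi>(4) by simp
      show "AE x in lborel. norm (\<phi> x *\<^sub>R g x) \<le> norm (B * \<phi> x)"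
        using \<phi>(2) by (intro AE_I2)
          (simp add: abs_mult mult.commute[of "\<bar>B\<bar>"] mult_left_mono order_trans[OF gB abs_ge_self])
    qed measurable
    moreover have "integrable lborel (\<lambda>x. \<phi> x *\<^sub>R f x)"
      using \<phi>(2,3) by (intro Bochner_Integration.integrable_bound[OF f]) (auto simp: mult_left_le_one_le)
    ultimately show "(LINT x|lborel. \<phi> x *\<^sub>R (g x - f x)) = 0"
      by (simp add: scaleR_diff_right)
  qed measurable
  then show ?thesis by (simp add: g_def)
qed

subsection \<open>Radial Fourier transforms\<close>

text \<open>Completeness of \<open>lebesgue\<close> makes anything that agrees almost everywhere
  with a Borel function measurable. This exchanges the integrals in the statement for Borel ones
  over \<open>lborel\<close>, where Fubini is available.\<close>

lemma lebesgue_AE_eq: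
  fixes \<Phi> \<Psi> :: "'a::euclidean_space \<Rightarrow> 'b::{banach, second_countable_topology}"
  assumes \<Psi>: "\<Psi> \<in> borel_measurable borel" and AE: "AE x in lborel. \<Phi> x = \<Psi> x"
  shows "\<Phi> \<in> borel_measurable lebesgue"
    and "integrable lebesgue \<Phi> \<longleftrightarrow> integrable lborel \<Psi>"
    and "integral\<^sup>L lebesgue \<Phi> = integral\<^sup>L lborel \<Psi>"
proof -
  have \<Psi>l: "\<Psi> \<in> borel_measurable lebesgue" using \<Psi> by (intro measurable_completion) simp
  have AEl: "AE x in lebesgue. \<Phi> x = \<Psi> x" using AE by (rule AE_completion)
  show \<Phi>: "\<Phi> \<in> borel_measurable lebesgue"
  proof (rule measurableI)
    fix A :: "'b set" assume A: "A \<in> sets borel"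
    show "\<Phi> -` A \<inter> space lebesgue \<in> sets lebesgue"
    proof (rule completion.in_sets_AE)
      show "\<Psi> -` A \<inter> space lebesgue \<in> sets lebesgue" using \<Psi>l A by (rule measurable_sets)
      show "AE x in lebesgue. x \<in> \<Psi> -` A \<inter> space lebesgue \<longleftrightarrow> x \<in> \<Phi> -` A \<inter> space lebesgue"
        using AEl by eventually_elim auto
    qed auto
  qed simp
  show "integrable lebesgue \<Phi> \<longleftrightarrow> integrable lborel \<Psi>"
    using integrable_cong_AE[OF \<Phi> \<Psi>l AEl] integrable_completion[of \<Psi> lborel] \<Psi> by simp
  show "integral\<^sup>L lebesgue \<Phi> = integral\<^sup>L lborel \<Psi>"
    using integral_cong_AE[OF \<Phi> \<Psi>l AEl] integral_completion[of \<Psi> lborel] \<Psi> by simp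
qed

lemma exp_eq_cis:
  "exp (- 2 * pi * \<i> * complex_of_real t) = cis (- 2 * pi * t)"
  "exp (2 * pi * \<i> * complex_of_real t) = cis (2 * pi * t)"
  by (simp_all add: cis_conv_exp mult_ac)

lemma fourier_eq:
  fixes \<Phi> \<Psi> :: "'a::euclidean_space \<Rightarrow> complex"
  assumes [measurable]: "\<Psi> \<in> borel_measurable borel" and AE: "AE x in lborel. \<Phi> x = \<Psi> x"
  shows "fourier \<Phi> v = (LINT x|lborel. cis (- 2 * pi * (x \<bullet> v)) * \<Psi> x)"
  unfolding fourier_def exp_eq_cis
  by (rule lebesgue_AE_eq(3)) (use AE in auto)

lemma inv_fourier_eq:
  fixes \<Phi> :: "'a::euclidean_space \<Rightarrow> complex"
  assumes [measurable]: "\<Phi> \<in> borel_measurable borel"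
  shows "inv_fourier \<Phi> x = (LINT v|lborel. cis (2 * pi * (x \<bullet> v)) * \<Phi> v)"
  unfolding inv_fourier_def exp_eq_cis
  by (rule lebesgue_AE_eq(3)) auto

lemma integral_uniform_sphere:
  fixes h :: "'a::euclidean_space \<Rightarrow> real"
  assumes "h \<in> borel_measurable borel"
  shows "(LINT \<xi>|uniform_sphere. h \<xi>) = (LINT \<xi>|sphere_measure. h \<xi>) / sphere_area DIM('a)"
proof -
  let ?\<omega> = "sphere_area DIM('a)"
  have pos: "?\<omega> > 0" by (rule sphere_area_pos) simp
  have [measurable]: "h \<in> borel_measurable (sphere_measure :: 'a measure)"
    by (rule measurable_sphere_measure) fact
  have "sphere 0 1 \<in> sets (sphere_measure :: 'a measure)"
    by (metis space_sphere_measure sets.top)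
  then have [measurable]: "(indicator (sphere 0 1) :: 'a \<Rightarrow> ennreal) \<in> borel_measurable sphere_measure"
    by simp
  have "(uniform_sphere :: 'a measure) = density sphere_measure (\<lambda>_. ennreal (1 / ?\<omega>))"
    unfolding uniform_sphere_def uniform_measure_def
  proof (rule density_cong)
    show "AE \<xi> in sphere_measure. indicator (sphere 0 1) \<xi> / emeasure (sphere_measure :: 'a measure) (sphere 0 1) = ennreal (1 / ?\<omega>)"
      using pos by (intro AE_I2) (simp add: emeasure_sphere_measure_sphere divide_ennreal flip: ennreal_1)
  qed measurable
  then have "integral\<^sup>L uniform_sphere h = integral\<^sup>L (density sphere_measure (\<lambda>_. ennreal (1 / ?\<omega>))) h"
    by (rule arg_cong)
  also have "\<dots> = (LINT \<xi>|sphere_measure. (1 / ?\<omega>) *\<^sub>R h \<xi>)"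
    by (rule integral_density) (use pos in auto)
  finally show ?thesis by simp
qed

text \<open>Reflecting the second half pairs each exponential with its conjugate, and the sum is
  twice a cosine. At \<open>r = 0\<close> the two halves overlap, so the decomposition is required
  only off that null point.\<close>

lemma fourier_even_extension:
  fixes w q :: "real \<Rightarrow> real"
  assumes w: "integrable lborel w" and q: "q \<in> borel_measurable borel"
    and eq: "\<And>r. r \<noteq> 0 \<Longrightarrow> q r = w r + w (- r)"
  shows "integrable lborel q"
    and "(LINT r|lborel. cis (- 2 * pi * (r \<bullet> s)) * complex_of_real (q r)) =
      complex_of_real (2 * cos_transform w (2 * pi * s))"
proof -
  have [measurable]: "w \<in> borel_measurable borel" using w by auto
  note q[measurable]
  have w': "integrable lborel (\<lambda>r. w (- r))"
    using lborel_integrable_real_affine[OF w, of "-1" 0] by simp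
  have AE: "AE r in lborel. q r = w r + w (- r)"
    using AE_lborel_singleton[of 0] by eventually_elim (rule eq)
  show int: "integrable lborel q"
    using Bochner_Integration.integrable_add[OF w w'] by (rule integrable_cong_AE_imp) (use AE in auto)
  let ?e = "\<lambda>r. cis (- 2 * pi * (r * s))"
  have i1: "integrable lborel (\<lambda>r. ?e r * complex_of_real (w r))"
    by (intro integrable_cis_mult integrable_of_real w) measurable
  have i2: "integrable lborel (\<lambda>r. ?e r * complex_of_real (w (- r)))"
    by (intro integrable_cis_mult integrable_of_real w') measurable
  have i3: "integrable lborel (\<lambda>r. cis (2 * pi * (r * s)) * complex_of_real (w r))"
    by (intro integrable_cis_mult integrable_of_real w) measurable
  have "(LINT r|lborel. cis (- 2 * pi * (r \<bullet> s)) * complex_of_real (q r)) =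
      (LINT r|lborel. ?e r * complex_of_real (w r) + ?e r * complex_of_real (w (- r)))"
    by (rule integral_cong_AE) (use AE in \<open>auto simp: distrib_left elim!: eventually_mono\<close>)
  also have "\<dots> = (LINT r|lborel. ?e r * complex_of_real (w r)) + (LINT r|lborel. ?e r * complex_of_real (w (- r)))"
    by (rule Bochner_Integration.integral_add[OF i1 i2])
  also have "(LINT r|lborel. ?e r * complex_of_real (w (- r))) = (LINT r|lborel. cis (2 * pi * (r * s)) * complex_of_real (w r))"
    using lborel_integral_real_affine[of "-1" "\<lambda>r. ?e r * complex_of_real (w (- r))" 0] by simp
  also have "(LINT r|lborel. ?e r * complex_of_real (w r)) + \<dots> =
      (LINT r|lborel. ?e r * complex_of_real (w r) + cis (2 * pi * (r * s)) * complex_of_real (w r))"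
    by (rule Bochner_Integration.integral_add[OF i1 i3, symmetric])
  also have "\<dots> = (LINT r|lborel. complex_of_real (2 * (w r * cos ((2 * pi * s) * r))))"
    by (intro Bochner_Integration.integral_cong refl) (simp add: complex_eq_iff mult_ac)
  also have "\<dots> = complex_of_real (2 * cos_transform w (2 * pi * s))"
    by (simp only: integral_complex_of_real integral_mult_right_zero cos_transform_def)
  finally show "(LINT r|lborel. cis (- 2 * pi * (r \<bullet> s)) * complex_of_real (q r)) =
      complex_of_real (2 * cos_transform w (2 * pi * s))" .
qed

lemma continuous_cos_transform:
  assumes w: "integrable lborel w"
  shows "continuous_on UNIV (cos_transform w)"
  unfolding cos_transform_def[abs_def]
  by (rule continuous_integral[where w = "\<lambda>r. \<bar>w r\<bar>"])
     (use w in \<open>auto intro!: continuous_intros simp: abs_mult mult_left_le\<close>)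

lemma fourier_radial:
  fixes p :: "real \<Rightarrow> real" and x :: "'a::euclidean_space"
  assumes [measurable]: "p \<in> borel_measurable borel"
    and int: "integrable lborel (\<lambda>y :: 'a. p (norm y))"
  defines "w \<equiv> \<lambda>r. indicator {0..} r * r ^ (DIM('a) - 1) * p r"
  shows "Re (LINT y|lborel. cis (- 2 * pi * (y \<bullet> x)) * complex_of_real (p (norm y))) =
    (LINT \<xi>|sphere_measure. cos_transform w (2 * pi * (x \<bullet> \<xi>)))"
proof -
  let ?h = "\<lambda>y. cis (- 2 * pi * (y \<bullet> x)) * complex_of_real (p (norm y))"
  have inth: "integrable lborel ?h"
    by (intro integrable_cis_mult integrable_of_real int) measurable
  have "Re (integral\<^sup>L lborel ?h) = (LINT y|lborel. Re (?h y))"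
    by (rule integral_Re[OF inth, symmetric])
  also have "\<dots> = (LINT \<xi>|sphere_measure. LINT r|lborel. (indicator {0..} r * r ^ (DIM('a) - 1)) *\<^sub>R Re (?h (r *\<^sub>R \<xi>)))"
    by (rule integral_polar[OF integrable_Re[OF inth]])
  also have "\<dots> = (LINT \<xi>|sphere_measure. cos_transform w (2 * pi * (x \<bullet> \<xi>)))"
    unfolding cos_transform_def
  proof (intro Bochner_Integration.integral_cong refl)
    fix \<xi> :: 'a and r :: real
    assume "\<xi> \<in> space sphere_measure"
    then show "(indicator {0..} r * r ^ (DIM('a) - 1)) *\<^sub>R Re (?h (r *\<^sub>R \<xi>)) = w r * cos (2 * pi * (x \<bullet> \<xi>) * r)"
      \<comment> \<open>For \<open>r \<ge> 0\<close> the norm of \<open>r *\<^sub>R \<xi>\<close> is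
        \<open>r\<close>; for negative \<open>r\<close> both sides vanish through the
        indicator.\<close>
      by (cases "r \<ge> 0") (auto simp: w_def mult_ac inner_commute)
  qed
  finally show ?thesis .
qed

text \<open>On almost every sphere the exceptional set is null, so the integrand is almost
  everywhere the constant \<open>c r\<close>, and the total mass of the sphere cancels the
  normalization.\<close>

lemma AE_avg_op:
  fixes \<Phi> :: "'a::euclidean_space \<Rightarrow> complex"
  assumes [measurable]: "\<Phi> \<in> borel_measurable borel"
    and AE: "AE x in lborel. \<Phi> x = c (norm x)"
  shows "AE r in lborel. r > 0 \<longrightarrow> avg_op \<Phi> r = c r"
proof -
  from AE obtain N where N: "N \<in> null_sets lborel" "{x. \<Phi> x \<noteq> c (norm x)} \<subseteq> N"
    by (auto simp: eventually_ae_filter)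
  from AE_polar(2)[OF N(1)] show ?thesis
  proof eventually_elim
    case (elim r)
    show ?case
    proof
      assume r: "r > 0"
      with elim have ae: "AE \<xi> in sphere_measure. r *\<^sub>R \<xi> \<notin> N" by simp
      have [measurable]: "(\<lambda>\<xi>. \<Phi> (r *\<^sub>R \<xi>)) \<in> borel_measurable sphere_measure"
        by (intro measurable_sphere_measure) measurable
      have "(LINT \<xi>|sphere_measure. \<Phi> (r *\<^sub>R \<xi>)) = (LINT (\<xi>::'a)|sphere_measure. c r)"
      proof (rule integral_cong_AE)
        show "AE \<xi> in sphere_measure. \<Phi> (r *\<^sub>R \<xi>) = c r"
          using ae AE_space
        proof eventually_elim
          case (elim \<xi>)
          then have "\<Phi> (r *\<^sub>R \<xi>) = c (norm (r *\<^sub>R \<xi>))" using N(2) by blast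
          with elim r show ?case by simp
        qed
      qed measurable
      then show "avg_op \<Phi> r = c r"
        using sphere_area_pos[OF DIM_positive[where 'a = 'a]]
        by (simp add: avg_op_def measure_sphere_measure_sphere)
    qed
  qed
qed

text \<open>Integrals of non-integrable functions default to 0, so the integrability of the
  functions being transformed or averaged is asserted along with the identities. The function
  \<open>f\<close> is required to be real, while \<open>fourier\<close> is complex valued; hence the
  coercions. The even extension of \<open>\<rho>\<close> is built into \<open>mult_op\<close>, which
  evaluates at \<open>\<bar>r\<bar>\<close>.\<close>

theorem proposition3p1:
  fixes F \<rho> :: "real \<Rightarrow> real"
  assumes dim: "DIM('a::euclidean_space) \<ge> 3"
    and rho: "integrable lebesgue (rot_op \<rho> :: 'a \<Rightarrow> real)"
    and F: "complex_of_real \<circ> (rot_op F :: 'a \<Rightarrow> real) =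
              fourier (complex_of_real \<circ> (rot_op \<rho> :: 'a \<Rightarrow> real))"
  shows "\<exists>f :: real \<Rightarrow> real.
    integrable lebesgue (mult_op DIM('a) \<rho>) \<and>
    (\<forall>r. complex_of_real (f r) = of_real (sphere_area DIM('a) / 2) *
           fourier (complex_of_real \<circ> mult_op DIM('a) \<rho>) r) \<and>
    f \<in> C0 \<and>
    (\<forall>r. f (- r) = f r) \<and>
    (\<forall>x :: 'a. F (norm x) = (LINT \<xi>|uniform_sphere. f \<bar>x \<bullet> \<xi>\<bar>)) \<and>
    (integrable lebesgue (rot_op F :: 'a \<Rightarrow> real) \<longrightarrow>
      (let \<Phi> = inv_fourier (complex_of_real \<circ> (rot_op F :: 'a \<Rightarrow> real));
           g = mult_op DIM('a) (avg_op \<Phi>)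
       in (\<forall>r. integrable sphere_measure (\<lambda>\<xi>. \<Phi> (r *\<^sub>R \<xi>))) \<and>
          integrable lebesgue g \<and>
          (\<forall>r. complex_of_real (f r) = of_real (sphere_area DIM('a) / 2) * fourier g r)))"
proof -
  let ?d = "DIM('a)" and ?\<omega> = "sphere_area DIM('a)"
  have \<omega>: "?\<omega> > 0" by (rule sphere_area_pos) simp
  obtain p where p[measurable]: "p \<in> borel_measurable borel"
    and p1: "AE r in lborel. r > 0 \<longrightarrow> \<rho> r = p r"
    and p2: "AE x in (lborel :: 'a measure). \<rho> (norm x) = p (norm x)"
    and p_int: "integrable lborel (\<lambda>x :: 'a. p (norm x))"
    using radial_borel_representative[of \<rho>, where 'a = 'a] rho by (auto simp: rot_op_def[abs_def])
  define w where "w r = indicator {0..} r * r ^ (?d - 1) * p r" for r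
  have w: "integrable lborel w"
    unfolding w_def by (rule integrable_radial[OF p p_int])
  define q where "q r = \<bar>r\<bar> ^ (?d - 1) * p \<bar>r\<bar>" for r
  have q[measurable]: "q \<in> borel_measurable borel" unfolding q_def by measurable
  have "q r = w r + w (- r)" if "r \<noteq> 0" for r
    using that by (auto simp: q_def w_def indicator_def)
  note q_even = fourier_even_extension[OF w q this]
  \<comment> \<open>In this form \<open>f\<close> is visibly real and even. The transform of
    \<open>q\<close> is twice the cosine transform, so the factor 1/2 has already been
    absorbed.\<close>
  define f where "f s = ?\<omega> * cos_transform w (2 * pi * s)" for s
  have f_q: "complex_of_real (f s) = of_real (?\<omega> / 2) * fourier G s" if "AE r in lborel. G r = complex_of_real (q r)" for G s
  proof -
    have "fourier G s = (LINT r|lborel. cis (- 2 * pi * (r \<bullet> s)) * complex_of_real (q r))"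
      by (rule fourier_eq) (use that in auto)
    also have "\<dots> = complex_of_real (2 * cos_transform w (2 * pi * s))"
      by (rule q_even)
    finally show ?thesis by (simp add: f_def)
  qed
  have mult_q: "AE r in lborel. mult_op ?d c r = of_real (q r)" if "AE r in lborel. r > 0 \<longrightarrow> c r = of_real (p r)" for c :: "real \<Rightarrow> 'c::real_normed_algebra_1"
    \<comment> \<open>In dimension one the norm is the absolute value, so agreement at almost all
      positive radii extends to almost all real \<open>r\<close>.\<close>
    using AE_norm[OF that, where 'a = real] AE_lborel_singleton[of 0]
    by eventually_elim (simp add: mult_op_def q_def scaleR_conv_of_real)

  have C0: "f \<in> C0"
  proof -
    have "continuous_on UNIV f"
      unfolding f_def
      by (intro continuous_intros continuous_on_compose2[OF continuous_cos_transform[OF w]]) auto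
    moreover have "((\<lambda>s. cos_transform w (2 * pi * s)) \<longlongrightarrow> 0) at_infinity"
      by (rule filterlim_compose[OF cos_transform_tendsto_0[OF w]])
         (rule tendsto_mult_filterlim_at_infinity[OF tendsto_const _ filterlim_ident], simp)
    then have "(f \<longlongrightarrow> 0) at_infinity"
      unfolding f_def by (rule tendsto_mult_right_zero)
    ultimately show ?thesis by (simp add: C0_def)
  qed
  have even: "f (- r) = f r" for r
    by (simp add: f_def cos_transform_def)

  define fh where "fh v = (LINT y|lborel. cis (- 2 * pi * (y \<bullet> v)) * complex_of_real (p (norm y)))" for v :: 'a
  have pc_int: "integrable lborel (\<lambda>y :: 'a. complex_of_real (p (norm y)))"
    by (intro integrable_of_real p_int)
  have fh: "complex_of_real (F (norm v)) = fh v" for v :: 'a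
  proof -
    have "complex_of_real (F (norm v)) = fourier (complex_of_real \<circ> (rot_op \<rho> :: 'a \<Rightarrow> real)) v"
      using fun_cong[OF F, of v] by (simp add: rot_op_def)
    also have "\<dots> = fh v"
      unfolding fh_def by (rule fourier_eq) (use p2 in \<open>auto simp: rot_op_def\<close>)
    finally show ?thesis .
  qed
  have expect: "F (norm x) = (LINT \<xi>|uniform_sphere. f \<bar>x \<bullet> \<xi>\<bar>)" for x :: 'a
  proof -
    have f_abs: "f \<bar>s\<bar> = f s" for s
      using even[of s] by (cases "s \<ge> 0") auto
    have f_meas[measurable]: "f \<in> borel_measurable borel"
      using C0 by (intro borel_measurable_continuous_onI) (simp add: C0_def)
    have "F (norm x) = Re (fh x)" by (simp flip: fh)
    also have "\<dots> = (LINT \<xi>|sphere_measure. cos_transform w (2 * pi * (x \<bullet> \<xi>)))"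
      unfolding fh_def w_def by (rule fourier_radial[OF p p_int])
    also have "\<dots> = (LINT \<xi>|sphere_measure. f (x \<bullet> \<xi>)) / ?\<omega>"
      using \<omega> by (simp add: f_def)
    also have "\<dots> = (LINT \<xi>|uniform_sphere. f (x \<bullet> \<xi>))"
      by (rule integral_uniform_sphere[symmetric]) measurable
    finally show ?thesis by (simp add: f_abs)
  qed

  have inversion: "(\<forall>r. integrable sphere_measure (\<lambda>\<xi>. \<Phi> (r *\<^sub>R \<xi>))) \<and>
      (AE r in lborel. mult_op ?d (avg_op \<Phi>) r = complex_of_real (q r))"
    if FL: "integrable lebesgue (rot_op F :: 'a \<Rightarrow> real)"
      and \<Phi>_def: "\<Phi> = inv_fourier (complex_of_real \<circ> (rot_op F :: 'a \<Rightarrow> real))" for \<Phi> :: "'a \<Rightarrow> complex"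
  proof -
    have "continuous_on UNIV fh"
      unfolding fh_def by (rule continuous_cis_integral[OF pc_int])
    then have [measurable]: "fh \<in> borel_measurable borel"
      by (rule borel_measurable_continuous_onI)
    have rot: "complex_of_real \<circ> (rot_op F :: 'a \<Rightarrow> real) = fh"
      by (auto simp: fun_eq_iff rot_op_def fh)
    \<comment> \<open>As the real part of a continuous function the rotated \<open>F\<close> is
      Borel, so its integrability passes from \<open>lebesgue\<close> to
      \<open>lborel\<close>.\<close>
    have "rot_op F = (\<lambda>x. Re (fh x))"
      by (auto simp: fun_eq_iff rot_op_def simp flip: fh)
    then have "(rot_op F :: 'a \<Rightarrow> real) \<in> borel_measurable borel" by simp
    then have "integrable lborel (rot_op F :: 'a \<Rightarrow> real)"
      using FL by (simp add: integrable_completion)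
    then have fh_int: "integrable lborel fh"
      unfolding rot[symmetric] o_def by (rule integrable_of_real)
    have \<Phi>: "\<Phi> x = (LINT v|lborel. cis (2 * pi * (x \<bullet> v)) * fh v)" for x
      unfolding \<Phi>_def rot by (rule inv_fourier_eq) measurable
    then have "\<Phi> = (\<lambda>x. LINT v|lborel. cis (2 * pi * (v \<bullet> x)) * fh v)"
      by (simp add: fun_eq_iff inner_commute)
    then have "continuous_on UNIV \<Phi>"
      using continuous_cis_integral[OF fh_int] by simp
    then have \<Phi>_meas[measurable]: "\<Phi> \<in> borel_measurable borel"
      by (rule borel_measurable_continuous_onI)
    have "AE x in lborel. \<Phi> x = complex_of_real (p (norm x))"
      unfolding \<Phi> fh_def using fh_int by (intro fourier_inversion pc_int) (simp add: fh_def[abs_def])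
    from AE_avg_op[OF \<Phi>_meas this]
    have 1: "AE r in lborel. mult_op ?d (avg_op \<Phi>) r = complex_of_real (q r)"
      by (rule mult_q)
    \<comment> \<open>The inverse transform is bounded by the L1 norm of \<open>fh\<close>, and the
      surface measure is finite; this covers every radius, not just almost every one.\<close>
    have 2: "integrable sphere_measure (\<lambda>\<xi>. \<Phi> (r *\<^sub>R \<xi>))" for r
    proof (rule finite_measure.integrable_const_bound[OF finite_sphere_measure])
      show "AE \<xi> in sphere_measure. norm (\<Phi> (r *\<^sub>R \<xi>)) \<le> (LINT v|lborel. norm (fh v))"
      proof (rule AE_I2)
        fix \<xi> :: 'a
        have "norm (\<Phi> (r *\<^sub>R \<xi>)) \<le> (LINT v|lborel. norm (cis (2 * pi * ((r *\<^sub>R \<xi>) \<bullet> v)) * fh v))"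
          unfolding \<Phi> by (rule integral_norm_bound)
        then show "norm (\<Phi> (r *\<^sub>R \<xi>)) \<le> (LINT v|lborel. norm (fh v))"
          by (simp add: norm_mult)
      qed
      show "(\<lambda>\<xi>. \<Phi> (r *\<^sub>R \<xi>)) \<in> borel_measurable sphere_measure"
        by (intro measurable_sphere_measure) measurable
    qed
    from 1 2 show ?thesis by blast
  qed

  have mult_rho: "AE r in lborel. mult_op ?d \<rho> r = q r"
    using mult_q[of \<rho>] p1 by simp
  show ?thesis
  proof (rule exI[of _ f], intro conjI allI impI)
    show "integrable lebesgue (mult_op ?d \<rho>)"
      using lebesgue_AE_eq(2)[OF q mult_rho] q_even(1) by simp
    show "complex_of_real (f r) = of_real (?\<omega> / 2) * fourier (complex_of_real \<circ> mult_op ?d \<rho>) r" for r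
      by (rule f_q) (use mult_rho in \<open>auto elim!: eventually_mono\<close>)
    show "f \<in> C0" "f (- r) = f r" "F (norm x) = (LINT \<xi>|uniform_sphere. f \<bar>x \<bullet> \<xi>\<bar>)" for r and x :: 'a
      by (fact C0 even expect)+
    assume FL: "integrable lebesgue (rot_op F :: 'a \<Rightarrow> real)"
    note inv = inversion[OF FL refl]
    have "integrable lebesgue (mult_op ?d (avg_op (inv_fourier (complex_of_real \<circ> (rot_op F :: 'a \<Rightarrow> real)))))"
      using lebesgue_AE_eq(2)[OF _ conjunct2[OF inv]] integrable_of_real[OF q_even(1)] by simp
    then show "let \<Phi> = inv_fourier (complex_of_real \<circ> (rot_op F :: 'a \<Rightarrow> real));
           g = mult_op DIM('a) (avg_op \<Phi>)
       in (\<forall>r. integrable sphere_measure (\<lambda>\<xi>. \<Phi> (r *\<^sub>R \<xi>))) \<and>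
          integrable lebesgue g \<and>
          (\<forall>r. complex_of_real (f r) = of_real (sphere_area DIM('a) / 2) * fourier g r)"
      unfolding Let_def using inv f_q by blast
  qed
qed

end
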